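(* Let $X$ be a metrisable space, let $d$ be a metric generating the topology on $X$, and let $d_{\rm part}$ and $d_{\rm tot}$ be defined on $\mathcal K_{\rm tot}(X)$ by $$d_{\rm part}(K_1,K_2):=d^2_{\rm H}\big(K_1^{\langle 2\rangle},K_2^{\langle 2\rangle}\big),\qquad d_{\rm tot}(K_1,K_2):=\inf_{R\in{\rm Cor}_+(K_1,K_2)}\ \sup_{(x_1,x_2)\in R}d(x_1,x_2).$$ Then: (a) $d_{\rm part}$ and $d_{\rm tot}$ are metrics that generate the same topology on $\mathcal K_{\rm tot}(X)$, and this topology (the ordered Hausdorff topology) does not depend on the choice of the metric $d$ generating the topology on $X$. (b) If $X$ is Polish, then so is $\mathcal K_{\rm tot}(X)$. (c) $d_{\rm H}(K_1,K_2)\le d_{\rm part}(K_1,K_2)\le d_{\rm tot}(K_1,K_2)$ for all $K_1,K_2\in\mathcal K_{\rm tot}(X)$, where $d_{\rm H}$ is the Hausdorff distance between the sets $K_1$ and $K_2$ with respect to $d$. (d) If $X=[0,1]$ with the usual distance, then for each $\varepsilon>0$ there exist $K_1,K_2\in\mathcal K_{\rm tot}(X)$ with $K_1\ne K_2$ such that $d_{\rm part}(K_1,K_2)\le\varepsilon\, d_{\rm tot}(K_1,K_2)$.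
   Context: A topological space is Polish if it is separable and its topology is generated by some complete metric. $\mathcal K_{\rm tot}(X)$ is the set of pairs $(K,\preceq)$ (often just written $K$) where $K$ is a nonempty compact subset of $X$ and $\preceq$ is a total order on $K$ such that $K^{\langle 2\rangle}:=\{(x,y)\in K^2:x\preceq y\}$ is a closed subset of $K^2$. Two elements of $\mathcal K_{\rm tot}(X)$ are equal iff both the sets and the orders agree. $d^2_{\rm H}$ is the Hausdorff metric on nonempty compact subsets of $X^2$ associated with the metric $d^2((x_1,y_1),(x_2,y_2)):=d(x_1,x_2)\vee d(y_1,y_2)$. ${\rm Cor}_+(K_1,K_2)$ is the set of monotone correspondences between $K_1$ and $K_2$, i.e. sets $R\subset K_1\times K_2$ such that every $x_1\in K_1$ has some $x_2\in K_2$ with $(x_1,x_2)\in R$, every $x_2\in K_2$ has some $x_1\in K_1$ with $(x_1,x_2)\in R$, and there are no $(x_1,x_2),(x_1',x_2')\in R$ with $x_1\prec x_1'$ and $x_2'\prec x_2$ (where $x\prec y$ means $x\preceq y$ and $x\neq y$). *)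

theory Defs
  imports "HOL-Analysis.Analysis"
begin

definition Polish_space :: "'a topology \<Rightarrow> bool" where
  "Polish_space X \<longleftrightarrow> separable_space X \<and> completely_metrizable_space X"

text \<open>A pair \<open>(K, r)\<close> is a compact set with a total order, where \<open>(x, y) \<in> r\<close> means \<open>x \<preceq> y\<close>.
  As \<^const>\<open>linear_order_on\<close> entails \<open>r \<subseteq> K \<times> K\<close>, the set \<open>K\<^sup>\<langle>\<^sup>2\<^sup>\<rangle>\<close> is \<open>r\<close> itself, and
  equality of pairs is equality of both the sets and the orders.\<close>

definition Ktot :: "'a topology \<Rightarrow> ('a set \<times> ('a \<times> 'a) set) set" where
  "Ktot X = {(K, r). K \<noteq> {} \<and> compactin X K \<and> linear_order_on K r \<and>
               closedin (subtopology (prod_topology X X) (K \<times> K)) r}"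

text \<open>The Hausdorff distance is only meaningful for nonempty bounded sets, since suprema and
  infima of reals are unspecified for empty or unbounded sets.\<close>

definition Hausdorff_dist :: "('a \<Rightarrow> 'a \<Rightarrow> real) \<Rightarrow> 'a set \<Rightarrow> 'a set \<Rightarrow> real" where
  "Hausdorff_dist d A B =
     max (SUP a\<in>A. INF b\<in>B. d a b) (SUP b\<in>B. INF a\<in>A. d a b)"

definition max_dist :: "('a \<Rightarrow> 'a \<Rightarrow> real) \<Rightarrow> 'a \<times> 'a \<Rightarrow> 'a \<times> 'a \<Rightarrow> real" where
  "max_dist d p q = max (d (fst p) (fst q)) (d (snd p) (snd q))"

definition monotone_correspondences ::
    "'a set \<times> ('a \<times> 'a) set \<Rightarrow> 'a set \<times> ('a \<times> 'a) set \<Rightarrow> ('a \<times> 'a) set set" where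
  "monotone_correspondences K1 K2 =
     {R. R \<subseteq> fst K1 \<times> fst K2 \<and>
         (\<forall>x1\<in>fst K1. \<exists>x2\<in>fst K2. (x1, x2) \<in> R) \<and>
         (\<forall>x2\<in>fst K2. \<exists>x1\<in>fst K1. (x1, x2) \<in> R) \<and>
         \<not> (\<exists>x1 x2 x1' x2'. (x1, x2) \<in> R \<and> (x1', x2') \<in> R \<and>
              (x1, x1') \<in> snd K1 \<and> x1 \<noteq> x1' \<and> (x2', x2) \<in> snd K2 \<and> x2' \<noteq> x2)}"

text \<open>The locale \<^locale>\<open>Metric_space\<close> requires metrics to be symmetric and nonnegative on the
  whole type, so both functions are extended by 0 outside \<^const>\<open>Ktot\<close>.\<close>

definition d_part ::
    "'a topology \<Rightarrow> ('a \<Rightarrow> 'a \<Rightarrow> real) \<Rightarrow>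
     'a set \<times> ('a \<times> 'a) set \<Rightarrow> 'a set \<times> ('a \<times> 'a) set \<Rightarrow> real" where
  "d_part X d K1 K2 =
     (if K1 \<in> Ktot X \<and> K2 \<in> Ktot X then Hausdorff_dist (max_dist d) (snd K1) (snd K2) else 0)"

definition d_tot ::
    "'a topology \<Rightarrow> ('a \<Rightarrow> 'a \<Rightarrow> real) \<Rightarrow>
     'a set \<times> ('a \<times> 'a) set \<Rightarrow> 'a set \<times> ('a \<times> 'a) set \<Rightarrow> real" where
  "d_tot X d K1 K2 =
     (if K1 \<in> Ktot X \<and> K2 \<in> Ktot X
      then INF R\<in>monotone_correspondences K1 K2. SUP (x1, x2)\<in>R. d x1 x2 else 0)"

end

theory Submission
  imports Defs
begin

text \<open>
  An element of \<^const>\<open>Ktot\<close> is determined by its order, a nonempty compact subset of the square, and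
  \<^const>\<open>d_part\<close> is the Hausdorff distance of the orders. So \<^const>\<open>d_part\<close> is a metric, and the work
  lies in the comparison with \<^const>\<open>d_tot\<close> and in completeness.

  For \<^const>\<open>d_tot\<close> the difficulty is to produce monotone correspondences: neither the composition of two
  of them (needed for the triangle inequality) nor the relation of being at distance less than \<open>\<delta>\<close>
  (needed to bound \<^const>\<open>d_tot\<close> in terms of \<^const>\<open>d_part\<close>) is monotone. One construction, lemma
  \<open>staircase_correspondence\<close>, handles both: it replaces a correspondence by the upper left boundary of
  its closure, which is always monotone, and which is no larger if swapping the second components of
  crossing pairs does not create large distances. For a composition, pairs can cross only through a
  common middle point, so swapping them is harmless. For pairs at distance less than \<open>\<delta>\<close>, a
  crossing yields an approximate cycle in the first order, and by compactness
  (\<open>Ktot_cycle_modulus\<close>) such cycles are short. Together with the elementary inequality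
  \<open>d_part_le_d_tot\<close> this shows that the two topologies coincide. The topology of \<^const>\<open>d_tot\<close>
  does not depend on \<open>d\<close>, because equivalent metrics are uniformly equivalent at the points of a
  compact set (\<open>equivalent_metrics_uniform_on_compact\<close>); hence neither does that of \<^const>\<open>d_part\<close>.

  For Polishness the metric \<open>d\<close> may therefore be taken complete. Then the nonempty compact subsets of
  the square form a complete separable space under the Hausdorff metric. Limits of linear
  orders are still reflexive and total, but antisymmetry and transitivity may be lost. Both express
  that there are no nontrivial cycles \<open>x \<preceq> y \<preceq> z \<preceq> x\<close>, and by \<open>Ktot_cycle_modulus\<close> a relation near
  a linear order has only small cycles; so the linear orders form a countable intersection of open sets
  inside a closed set (\<open>gdelta_in_Ktot\<close>), and such a subset of a Polish space is Polish.

  That the metrics are not Lipschitz equivalent is seen on a fine grid in the unit interval,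
  whose even and odd points are interleaved in space but separated in the order.
\<close>

section \<open>Comparing metrics\<close>

lemma mtopology_finer:
  assumes "Metric_space M d1" "Metric_space M d2"
    and le: "\<And>x \<epsilon>. x \<in> M \<Longrightarrow> \<epsilon> > 0 \<Longrightarrow> \<exists>\<delta>>0. \<forall>y\<in>M. d1 x y < \<delta> \<longrightarrow> d2 x y < \<epsilon>"
    and "openin (Metric_space.mtopology M d2) U"
  shows "openin (Metric_space.mtopology M d1) U"
proof -
  interpret m1: Metric_space M d1 by fact
  interpret m2: Metric_space M d2 by fact
  have U: "U \<subseteq> M" "\<And>x. x \<in> U \<Longrightarrow> \<exists>r>0. m2.mball x r \<subseteq> U"
    using assms(4) by (auto simp: m2.openin_mtopology)
  have "\<exists>r>0. m1.mball x r \<subseteq> U" if x: "x \<in> U" for x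
  proof -
    obtain r where r: "r > 0" "m2.mball x r \<subseteq> U" using U(2) x by blast
    then obtain e where e: "e > 0" "\<forall>y\<in>M. d1 x y < e \<longrightarrow> d2 x y < r"
      using le[of x r] U(1) x by blast
    then have "m1.mball x e \<subseteq> m2.mball x r" by auto
    with e r show ?thesis by blast
  qed
  with U show ?thesis by (auto simp: m1.openin_mtopology)
qed

lemma mtopology_eqI:
  assumes "Metric_space M d1" "Metric_space M d2"
    and "\<And>x \<epsilon>. x \<in> M \<Longrightarrow> \<epsilon> > 0 \<Longrightarrow> \<exists>\<delta>>0. \<forall>y\<in>M. d1 x y < \<delta> \<longrightarrow> d2 x y < \<epsilon>"
    and "\<And>x \<epsilon>. x \<in> M \<Longrightarrow> \<epsilon> > 0 \<Longrightarrow> \<exists>\<delta>>0. \<forall>y\<in>M. d2 x y < \<delta> \<longrightarrow> d1 x y < \<epsilon>"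
  shows "Metric_space.mtopology M d1 = Metric_space.mtopology M d2"
  unfolding topology_eq
  using mtopology_finer[OF assms(1,2,3)] mtopology_finer[OF assms(2,1,4)] by blast

text \<open>The identity between two equivalent metrics is continuous, and at the points of a compact set it is
  so uniformly, even when the second point is arbitrary. The Lebesgue number of the cover of \<open>K\<close> by
  \<open>d2\<close>-balls provides \<open>\<delta>\<close>. This is what makes topologies defined through distances from a
  compact set independent of the metric.\<close>

lemma equivalent_metrics_uniform_on_compact:
  assumes "Metric_space M d1" "Metric_space M d2"
    and eq: "Metric_space.mtopology M d1 = Metric_space.mtopology M d2"
    and K: "compactin (Metric_space.mtopology M d1) K" and "\<epsilon> > 0"
  shows "\<exists>\<delta>>0. \<forall>x\<in>K. \<forall>y\<in>M. d1 x y < \<delta> \<longrightarrow> d2 x y < \<epsilon>"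
proof -
  interpret m1: Metric_space M d1 by fact
  interpret m2: Metric_space M d2 by fact
  have KM: "K \<subseteq> M" using compactin_subset_topspace[OF K] by simp
  let ?C = "(\<lambda>x. m2.mball x (\<epsilon>/2)) ` M"
  have "\<exists>\<delta>>0. \<forall>x\<in>K. \<exists>U\<in>?C. m1.mball x \<delta> \<subseteq> U"
  proof (rule m1.lebesgue_number[OF K])
    show "K \<subseteq> \<Union> ?C" using KM \<open>\<epsilon> > 0\<close> by auto
    show "openin m1.mtopology U" if "U \<in> ?C" for U using that eq by auto
  qed
  then obtain \<delta> where "\<delta> > 0" and \<delta>: "\<And>x. x \<in> K \<Longrightarrow> \<exists>z\<in>M. m1.mball x \<delta> \<subseteq> m2.mball z (\<epsilon>/2)"
    by blast
  have "d2 x y < \<epsilon>" if xy: "x \<in> K" "y \<in> M" "d1 x y < \<delta>" for x y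
  proof -
    obtain z where z: "z \<in> M" "m1.mball x \<delta> \<subseteq> m2.mball z (\<epsilon>/2)" using \<delta> xy by blast
    have "x \<in> m1.mball x \<delta>" "y \<in> m1.mball x \<delta>" using xy KM \<open>\<delta> > 0\<close> by auto
    then have "x \<in> m2.mball z (\<epsilon>/2)" "y \<in> m2.mball z (\<epsilon>/2)" using z(2) by blast+
    then show ?thesis using m2.triangle''[of x z y] z(1) xy(2) by force
  qed
  with \<open>\<delta> > 0\<close> show ?thesis by blast
qed

section \<open>The Hausdorff metric on nonempty compact sets\<close>

context Metric_space
begin

lemma Hausdorff_dist_commute: "Hausdorff_dist d A B = Hausdorff_dist d B A"
  unfolding Hausdorff_dist_def by (simp add: commute max.commute)

lemma bdd_below_mdist: "bdd_below ((\<lambda>b. d a b) ` B)"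
  by (rule bdd_belowI[of _ 0]) auto

lemma Hausdorff_dist_le:
  assumes "A \<noteq> {}" "B \<noteq> {}"
    and "\<And>a. a \<in> A \<Longrightarrow> \<exists>b\<in>B. d a b \<le> c" "\<And>b. b \<in> B \<Longrightarrow> \<exists>a\<in>A. d a b \<le> c"
  shows "Hausdorff_dist d A B \<le> c"
proof -
  have half: "(SUP a\<in>A. INF b\<in>B. d a b) \<le> c"
    if "A \<noteq> {}" "\<And>a. a \<in> A \<Longrightarrow> \<exists>b\<in>B. d a b \<le> c" for A B
    using that by (auto intro!: cSUP_least intro: cINF_lower2[OF bdd_below_mdist])
  show ?thesis
    unfolding Hausdorff_dist_def
    using half[of A B] half[of B A] assms by (simp add: commute)
qed

lemma Hausdorff_dist_lessD:
  assumes "mbounded A" "mbounded B" "B \<noteq> {}" "Hausdorff_dist d A B < c" "a \<in> A"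
  obtains b where "b \<in> B" "d a b < c"
proof -
  obtain b0 where b0: "b0 \<in> B" using assms by blast
  have "mbounded (A \<union> B)" using assms by (simp add: mbounded_Un)
  then obtain C where C: "\<And>x y. x \<in> A \<union> B \<Longrightarrow> y \<in> A \<union> B \<Longrightarrow> d x y \<le> C"
    unfolding mbounded_alt by blast
  have "bdd_above ((\<lambda>a. INF b\<in>B. d a b) ` A)"
  proof (rule bdd_aboveI2)
    show "(INF b\<in>B. d a b) \<le> C" if "a \<in> A" for a
      using b0 C that by (intro cINF_lower2[OF bdd_below_mdist b0]) auto
  qed
  then have "(INF b\<in>B. d a b) \<le> (SUP a\<in>A. INF b\<in>B. d a b)"
    using assms by (intro cSUP_upper)
  also have "\<dots> < c" using assms unfolding Hausdorff_dist_def by simp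
  finally obtain b where "b \<in> B" "d a b < c"
    using assms by (subst (asm) cINF_less_iff[OF _ bdd_below_mdist]) auto
  then show ?thesis by (rule that)
qed

lemma Hausdorff_dist_nonneg:
  assumes "mbounded A" "mbounded B" "A \<noteq> {}" "B \<noteq> {}"
  shows "0 \<le> Hausdorff_dist d A B"
proof (rule ccontr)
  assume "\<not> ?thesis"
  then have "Hausdorff_dist d A B < 0" by simp
  moreover obtain a where "a \<in> A" using assms by blast
  ultimately obtain b where "d a b < 0" using Hausdorff_dist_lessD[OF assms(1,2,4)] by blast
  then show False using nonneg[of a b] by linarith
qed

definition nonempty_compacts :: "'a set set" where
  "nonempty_compacts = {A. A \<noteq> {} \<and> compactin mtopology A}"

text \<open>The function is extended by 0, since \<^locale>\<open>Metric_space\<close> constrains a metric on the whole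
  type.\<close>

definition hausdorff_metric :: "'a set \<Rightarrow> 'a set \<Rightarrow> real" where
  "hausdorff_metric A B =
     (if A \<in> nonempty_compacts \<and> B \<in> nonempty_compacts then Hausdorff_dist d A B else 0)"

lemma nonempty_compactsD:
  assumes "A \<in> nonempty_compacts"
  shows "A \<noteq> {}" "compactin mtopology A" "A \<subseteq> M" "mbounded A" "closedin mtopology A"
proof -
  show *: "A \<noteq> {}" "compactin mtopology A" using assms by (auto simp: nonempty_compacts_def)
  show "A \<subseteq> M" using compactin_subset_topspace[OF *(2)] by simp
  show "mbounded A" using compactin_imp_mbounded[OF *(2)] .
  show "closedin mtopology A" using compactin_imp_closedin[OF Hausdorff_space_mtopology *(2)] .
qed

lemma hausdorff_metric_le:
  assumes "A \<in> nonempty_compacts" "B \<in> nonempty_compacts"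
    and "\<And>a. a \<in> A \<Longrightarrow> \<exists>b\<in>B. d a b \<le> c" "\<And>b. b \<in> B \<Longrightarrow> \<exists>a\<in>A. d a b \<le> c"
  shows "hausdorff_metric A B \<le> c"
  using Hausdorff_dist_le[of A B c] assms nonempty_compactsD(1) by (auto simp: hausdorff_metric_def)

lemma hausdorff_metric_commute: "hausdorff_metric A B = hausdorff_metric B A"
  by (auto simp: hausdorff_metric_def Hausdorff_dist_commute)

lemma hausdorff_metric_lessD:
  assumes "A \<in> nonempty_compacts" "B \<in> nonempty_compacts" "hausdorff_metric A B < c" "a \<in> A"
  obtains b where "b \<in> B" "d a b < c"
  using Hausdorff_dist_lessD[of A B c a] assms nonempty_compactsD(1,4)
  by (auto simp: hausdorff_metric_def)

lemma mem_closedI: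
  assumes "closedin mtopology A" "x \<in> M" "\<And>e. e > 0 \<Longrightarrow> \<exists>a\<in>A. d x a < e"
  shows "x \<in> A"
proof -
  have "x \<in> mtopology closure_of A"
    using assms closedin_subset[OF assms(1)] by (force simp: metric_closure_of)
  then show ?thesis using assms(1) by (simp add: closure_of_closedin)
qed

lemma Metric_space_hausdorff_metric: "Metric_space nonempty_compacts hausdorff_metric"
proof
  show nn: "0 \<le> hausdorff_metric A B" for A B
    by (auto simp: hausdorff_metric_def dest: nonempty_compactsD intro!: Hausdorff_dist_nonneg)
  show "hausdorff_metric A B = hausdorff_metric B A" for A B
    by (rule hausdorff_metric_commute)
  show "(hausdorff_metric A B = 0) = (A = B)"
    if AB: "A \<in> nonempty_compacts" "B \<in> nonempty_compacts" for A B
  proof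
    have sub: "A \<subseteq> B" if "hausdorff_metric A B = 0"
      "A \<in> nonempty_compacts" "B \<in> nonempty_compacts" for A B
    proof
      fix x assume "x \<in> A"
      show "x \<in> B"
      proof (rule mem_closedI)
        show "closedin mtopology B" "x \<in> M"
          using that nonempty_compactsD(3,5) \<open>x \<in> A\<close> by blast+
        show "\<exists>a\<in>B. d x a < e" if "e > 0" for e
          using hausdorff_metric_lessD[of A B e x] \<open>x \<in> A\<close> that \<open>hausdorff_metric A B = 0\<close>
            \<open>A \<in> nonempty_compacts\<close> \<open>B \<in> nonempty_compacts\<close> by metis
      qed
    qed
    show "A = B" if "hausdorff_metric A B = 0"
      using sub[of A B] sub[of B A] that AB by (simp add: hausdorff_metric_commute)
    show "hausdorff_metric A B = 0" if "A = B"
    proof -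
      have "hausdorff_metric A A \<le> 0"
        using AB nonempty_compactsD(3)[OF AB(1)] by (intro hausdorff_metric_le) force+
      with nn[of A A] that show ?thesis by simp
    qed
  qed
  show "hausdorff_metric A C \<le> hausdorff_metric A B + hausdorff_metric B C"
    if "A \<in> nonempty_compacts" "B \<in> nonempty_compacts" "C \<in> nonempty_compacts" for A B C
  proof (rule field_le_epsilon)
    fix e :: real assume "e > 0"
    have half: "\<exists>c\<in>C. d a c \<le> hausdorff_metric A B + hausdorff_metric B C + e"
      if ABC: "a \<in> A" "A \<in> nonempty_compacts" "B \<in> nonempty_compacts" "C \<in> nonempty_compacts"
      for a A B C
    proof -
      obtain b where b: "b \<in> B" "d a b < hausdorff_metric A B + e/2"
        using hausdorff_metric_lessD[of A B "hausdorff_metric A B + e/2" a] ABC \<open>e > 0\<close> by auto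
      obtain c where c: "c \<in> C" "d b c < hausdorff_metric B C + e/2"
        using hausdorff_metric_lessD[of B C "hausdorff_metric B C + e/2" b] ABC \<open>e > 0\<close> b
        by auto
      have "d a c \<le> d a b + d b c"
        using ABC b c nonempty_compactsD(3) by (intro triangle) blast+
      with b c show ?thesis by (intro bexI[of _ c]) auto
    qed
    show "hausdorff_metric A C \<le> hausdorff_metric A B + hausdorff_metric B C + e"
    proof (rule hausdorff_metric_le[OF that(1,3)])
      show "\<exists>c\<in>C. d a c \<le> hausdorff_metric A B + hausdorff_metric B C + e" if "a \<in> A" for a
        using half that \<open>A \<in> _\<close> \<open>B \<in> _\<close> \<open>C \<in> _\<close> by blast
      show "\<exists>a\<in>A. d a c \<le> hausdorff_metric A B + hausdorff_metric B C + e" if "c \<in> C" for c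
        using half[of c C B A] that \<open>A \<in> _\<close> \<open>B \<in> _\<close> \<open>C \<in> _\<close>
        by (simp add: commute hausdorff_metric_commute add.commute)
    qed
  qed
qed

end

section \<open>Completeness and separability of the Hausdorff metric\<close>

context Metric_space
begin

lemma separable_space_mtopology_iff:
  "separable_space mtopology \<longleftrightarrow>
     (\<exists>C. countable C \<and> C \<subseteq> M \<and> (\<forall>x\<in>M. \<forall>e>0. \<exists>c\<in>C. d x c < e))"
proof -
  have "mtopology closure_of C = M \<longleftrightarrow> (\<forall>x\<in>M. \<forall>e>0. \<exists>c\<in>C. d x c < e)" if "C \<subseteq> M" for C
  proof -
    have "mtopology closure_of C = {x \<in> M. \<forall>e>0. \<exists>c\<in>C. d x c < e}"
      using that unfolding metric_closure_of by fastforce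
    then show ?thesis by blast
  qed
  then show ?thesis unfolding separable_space_def by auto
qed

text \<open>For each point \<open>c\<close> of a countable dense set and each radius, one point of \<open>S\<close> within that radius of
  \<open>c\<close> is chosen if there is any; the chosen points are dense in \<open>S\<close>.\<close>

lemma separable_space_subtopology_mtopology:
  assumes "separable_space mtopology" "S \<subseteq> M"
  shows "separable_space (subtopology mtopology S)"
proof -
  interpret sub: Submetric M d S by unfold_locales fact
  obtain C where C: "countable C" "C \<subseteq> M" "\<And>x e. x \<in> M \<Longrightarrow> e > 0 \<Longrightarrow> \<exists>c\<in>C. d x c < e"
    using assms(1) unfolding separable_space_mtopology_iff by blast
  define near where "near c n = {s \<in> S. d c s < inverse (real (Suc n))}" for c n
  define pick where "pick = (\<lambda>(c, n). SOME s. s \<in> near c n)"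
  define C' where "C' = pick ` {p \<in> C \<times> UNIV. near (fst p) (snd p) \<noteq> {}}"
  have pick: "pick (c, n) \<in> near c n" if "near c n \<noteq> {}" for c n
    using that unfolding pick_def by (auto intro: someI)
  have "countable C'" unfolding C'_def
    by (intro countable_image countable_subset[OF _ countable_SIGMA[OF C(1), of "\<lambda>_. UNIV"]]) auto
  moreover have "C' \<subseteq> S" unfolding C'_def using pick by (force simp: near_def)
  moreover have "\<exists>c\<in>C'. d x c < e" if x: "x \<in> S" and "e > 0" for x e
  proof -
    obtain n where n: "inverse (real (Suc n)) < e / 2"
      using reals_Archimedean[of "e/2"] \<open>e > 0\<close> by auto
    obtain c where c: "c \<in> C" "d x c < inverse (real (Suc n))"
      using C(3)[of x "inverse (real (Suc n))"] x assms(2) by auto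
    then have ne: "near c n \<noteq> {}" using that by (auto simp: near_def commute)
    then have "pick (c, n) \<in> C'" using c unfolding C'_def by force
    moreover have "d x (pick (c, n)) \<le> d x c + d c (pick (c, n))"
      using pick[OF ne] that c C(2) assms(2) by (intro triangle) (auto simp: near_def)
    moreover have "d c (pick (c, n)) < inverse (real (Suc n))" using pick[OF ne] by (simp add: near_def)
    ultimately show ?thesis using c n by (intro bexI[of _ "pick (c, n)"]) linarith+
  qed
  ultimately have "separable_space sub.sub.mtopology"
    unfolding sub.sub.separable_space_mtopology_iff by blast
  then show ?thesis by (simp add: sub.mtopology_submetric)
qed

end

context Metric_space
begin

interpretation hyp: Metric_space nonempty_compacts hausdorff_metric
  by (rule Metric_space_hausdorff_metric)

text \<open>The limit of a Cauchy sequence of compact sets \<open>S n\<close> is the set \<open>L\<close> of limits of points chosen from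
  the \<open>S n\<close>. That \<open>L\<close> is close to \<open>S n\<close> is immediate from its definition; conversely, a
  point of \<open>S n\<close> is close to some point of \<open>L\<close> because successive approximations in later
  sets converge by completeness. Being close to the totally bounded sets \<open>S n\<close>, the closed set
  \<open>L\<close> is compact.\<close>

lemma mcomplete_hausdorff_metric:
  assumes complete: mcomplete
  shows "Metric_space.mcomplete nonempty_compacts hausdorff_metric"
  unfolding hyp.mcomplete_def
proof (intro allI impI)
  fix S :: "nat \<Rightarrow> 'a set" assume "hyp.MCauchy S"
  then have rng: "range S \<subseteq> nonempty_compacts"
    and cau: "\<forall>e>0. \<exists>N. \<forall>n n'. N \<le> n \<longrightarrow> N \<le> n' \<longrightarrow> hausdorff_metric (S n) (S n') < e"
    unfolding hyp.MCauchy_def by auto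
  from rng have S: "\<And>n. S n \<in> nonempty_compacts" by auto
  from cau have cauchy:
    "\<And>e. e > 0 \<Longrightarrow> \<exists>N. \<forall>m\<ge>N. \<forall>n\<ge>N. hausdorff_metric (S m) (S n) < e" by metis
  have SM: "\<And>n. S n \<subseteq> M" using S nonempty_compactsD(3) by blast
  define L where "L = {x \<in> M. \<forall>e>0. \<exists>N. \<forall>n\<ge>N. \<exists>a\<in>S n. d x a < e}"
  have L_near: "\<exists>a\<in>S n. d x a < 2 * e"
    if e: "e > 0" and N: "\<forall>m\<ge>N. \<forall>n\<ge>N. hausdorff_metric (S m) (S n) < e" and "x \<in> L" "n \<ge> N"
    for e N x n
  proof -
    obtain N' where N': "\<forall>n\<ge>N'. \<exists>a\<in>S n. d x a < e" "x \<in> M"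
      using \<open>x \<in> L\<close> e unfolding L_def by blast
    define m where "m = max N N'"
    obtain a where a: "a \<in> S m" "d x a < e" using N'(1) unfolding m_def by (meson max.cobounded2)
    have "hausdorff_metric (S m) (S n) < e" using N \<open>n \<ge> N\<close> unfolding m_def by simp
    then obtain b where b: "b \<in> S n" "d a b < e"
      using hausdorff_metric_lessD S a by metis
    have "d x b \<le> d x a + d a b" using N'(2) a b SM by (intro triangle) auto
    with a b show ?thesis by force
  qed
  have near_L: "\<exists>x\<in>L. d a x < 2 * e"
    if e: "e > 0" and N: "\<forall>m\<ge>N. \<forall>n\<ge>N. hausdorff_metric (S m) (S n) < e / 2"
      and a: "a \<in> S n" and n: "n \<ge> N" for e N a n
  proof -
    \<comment> \<open>Along indices whose Hausdorff distances decay geometrically, successive nearby points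
      form a Cauchy sequence; its limit lies in \<open>L\<close>.\<close>
    have "\<forall>k::nat. \<exists>N. \<forall>m\<ge>N. \<forall>n\<ge>N. hausdorff_metric (S m) (S n) < e / 2 ^ Suc k"
      using cauchy e by simp
    then obtain B where B: "\<And>k m n. m \<ge> B k \<Longrightarrow> n \<ge> B k \<Longrightarrow>
        hausdorff_metric (S m) (S n) < e / 2 ^ Suc k"
      by metis
    define P where "P k p \<longleftrightarrow> snd p \<in> S (fst p) \<and> (if k = 0 then p = (n, a) else B k \<le> fst p)"
      for k and p :: "nat \<times> 'a"
    define Q where "Q k p q \<longleftrightarrow> fst p \<le> fst q \<and> d (snd p) (snd q) < e / 2 ^ Suc k"
      for k :: nat and p q :: "nat \<times> 'a"
    have "\<exists>f. \<forall>k. P k (f k) \<and> Q k (f k) (f (Suc k))"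
    proof (rule dependent_nat_choice)
      show "\<exists>p. P 0 p" using a unfolding P_def by force
      fix p k assume p: "P k p"
      define j where "j = max (fst p) (B (Suc k))"
      have "hausdorff_metric (S (fst p)) (S j) < e / 2 ^ Suc k"
      proof (cases "k = 0")
        case True
        then show ?thesis using p N n unfolding P_def j_def by auto
      next
        case False
        then show ?thesis using p unfolding P_def j_def by (intro B) auto
      qed
      then obtain b where "b \<in> S j" "d (snd p) b < e / 2 ^ Suc k"
        using hausdorff_metric_lessD S p unfolding P_def by metis
      then show "\<exists>q. P (Suc k) q \<and> Q k p q"
        unfolding P_def Q_def j_def by (intro exI[of _ "(j, b)"]) (auto simp: j_def)
    qed
    then obtain f where f: "\<And>k. P k (f k)" "\<And>k. Q k (f k) (f (Suc k))" by blast
    define x where "x k = snd (f k)" for k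
    define i where "i k = fst (f k)" for k
    have x: "\<And>k. x k \<in> S (i k)" "x 0 = a" "\<And>k. x k \<in> M"
      "\<And>k. d (x k) (x (Suc k)) < e / 2 ^ Suc k"
    proof -
      show xS: "x k \<in> S (i k)" for k using f(1)[of k] by (simp add: P_def x_def i_def)
      then show "x k \<in> M" for k using SM by blast
      show "x 0 = a" using f(1)[of 0] by (simp add: P_def x_def)
      show "d (x k) (x (Suc k)) < e / 2 ^ Suc k" for k using f(2)[of k] by (simp add: Q_def x_def)
    qed
    have i: "\<And>k. B (Suc k) \<le> i (Suc k)"
      using f unfolding P_def i_def by (metis nat.distinct(1))
    have tele: "d (x k) (x (k + l)) \<le> e / 2 ^ k - e / 2 ^ (k + l)" for k l
    proof (induction l)
      case (Suc l)
      have "d (x k) (x (k + Suc l)) \<le> d (x k) (x (k + l)) + d (x (k + l)) (x (Suc (k + l)))"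
        using triangle x(3) by simp
      also have "\<dots> \<le> e / 2 ^ k - e / 2 ^ (k + l) + e / 2 ^ Suc (k + l)"
        using Suc x(4)[of "k + l"] by linarith
      also have "\<dots> = e / 2 ^ k - e / 2 ^ (k + Suc l)" by (simp add: field_simps)
      finally show ?case .
    qed (simp add: x(3))
    have tele': "d (x k) (x l) \<le> e / 2 ^ k" if "k \<le> l" for k l
    proof -
      have "0 \<le> e / 2 ^ l" using e by simp
      then show ?thesis using tele[of k "l - k"] that by simp
    qed
    have small: "\<exists>k. e / 2 ^ k < c" if "c > 0" for c
    proof -
      obtain k where "(1/2) ^ k < c / e"
        using real_arch_pow_inv[of "c / e" "1/2"] \<open>c > 0\<close> e by auto
      then show ?thesis using e by (intro exI[of _ k]) (simp add: field_simps)
    qed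
    have "MCauchy x"
      unfolding MCauchy_def
    proof (intro conjI allI impI)
      show "range x \<subseteq> M" using x(3) by blast
      fix c :: real assume "c > 0"
      then obtain k where k: "e / 2 ^ k < c / 2" using small[of "c/2"] by auto
      have "d (x m) (x l) < c" if "k \<le> m" "k \<le> l" for m l
        using triangle''[of "x m" "x k" "x l"] tele'[of k m] tele'[of k l] k that x(3)[of m] x(3)[of k] x(3)[of l]
        by linarith
      then show "\<exists>N. \<forall>n n'. N \<le> n \<longrightarrow> N \<le> n' \<longrightarrow> d (x n) (x n') < c" by blast
    qed
    then obtain z where z: "limitin mtopology x z sequentially"
      using complete unfolding mcomplete_def by blast
    then have zM: "z \<in> M" by (rule limitin_mspace)
    have lim: "d (x k) z \<le> e / 2 ^ k" for k
    proof (rule field_le_epsilon)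
      fix c :: real assume "c > 0"
      then obtain m where m: "\<forall>n\<ge>m. d (x n) z < c" using z unfolding limit_metric_sequentially by blast
      have "d (x k) z \<le> d (x k) (x (max k m)) + d (x (max k m)) z"
        using triangle x(3) zM by blast
      also have "\<dots> \<le> e / 2 ^ k + c"
        using tele'[of k "max k m"] m by (intro add_mono) (auto simp: less_imp_le)
      finally show "d (x k) z \<le> e / 2 ^ k + c" .
    qed
    have "z \<in> L"
      unfolding L_def
    proof (intro CollectI conjI zM allI impI)
      fix c :: real assume "c > 0"
      then obtain k where k: "e / 2 ^ k < c / 2" using small[of "c/2"] by auto
      have k': "e / 2 ^ Suc k < c / 2" "e / 2 ^ Suc (Suc k) < c / 2"
        using k e by (auto simp: field_simps)
      have "\<exists>b\<in>S m. d z b < c" if "m \<ge> B (Suc k)" for m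
      proof -
        have "hausdorff_metric (S (i (Suc k))) (S m) < e / 2 ^ Suc (Suc k)"
          using B i that by blast
        then obtain b where b: "b \<in> S m" "d (x (Suc k)) b < e / 2 ^ Suc (Suc k)"
          using hausdorff_metric_lessD S x(1) by metis
        have "d z b \<le> d (x (Suc k)) z + d (x (Suc k)) b"
          using zM x(3) b(1) SM[of m] by (intro triangle'') auto
        then show ?thesis using lim[of "Suc k"] b k' by (intro bexI[of _ b]) auto
      qed
      then show "\<exists>N. \<forall>n\<ge>N. \<exists>a\<in>S n. d z a < c" by blast
    qed
    moreover have "d a z < 2 * e" using lim[of 0] x(2) e by simp
    ultimately show ?thesis by blast
  qed
  have LM: "L \<subseteq> M" unfolding L_def by blast
  have "L \<noteq> {}"
  proof -
    obtain N where N: "\<forall>m\<ge>N. \<forall>n\<ge>N. hausdorff_metric (S m) (S n) < 1 / 2"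
      using cauchy[of "1/2"] by auto
    obtain a where "a \<in> S N" using nonempty_compactsD(1)[OF S] by blast
    then show ?thesis using near_L[of 1 N a N] N by auto
  qed
  moreover have "compactin mtopology L"
  proof -
    have "closedin mtopology L"
      unfolding metric_closedin_iff_sequentially_closed
    proof (intro conjI LM allI impI)
      fix \<sigma> l assume \<sigma>: "range \<sigma> \<subseteq> L \<and> limitin mtopology \<sigma> l sequentially"
      have lM: "l \<in> M" using \<sigma> limitin_mspace by blast
      show "l \<in> L"
        unfolding L_def
      proof (intro CollectI conjI lM allI impI)
        fix e :: real assume e: "e > 0"
        then obtain k where k: "d (\<sigma> k) l < e / 2"
          using \<sigma> unfolding limit_metric_sequentially by (meson half_gt_zero order_refl)
        have "\<sigma> k \<in> L" using \<sigma> by blast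
        then have "\<forall>e>0. \<exists>N. \<forall>n\<ge>N. \<exists>a\<in>S n. d (\<sigma> k) a < e" unfolding L_def by simp
        then obtain N where N: "\<forall>n\<ge>N. \<exists>a\<in>S n. d (\<sigma> k) a < e / 2"
          using half_gt_zero[OF e] by blast
        have "\<exists>a\<in>S n. d l a < e" if n: "n \<ge> N" for n
        proof -
          obtain a where a: "a \<in> S n" "d (\<sigma> k) a < e / 2" using N n by blast
          have "d l a \<le> d (\<sigma> k) l + d (\<sigma> k) a"
            using lM a(1) SM[of n] \<open>\<sigma> k \<in> L\<close> LM by (intro triangle'') auto
          with a k show ?thesis by force
        qed
        then show "\<exists>N. \<forall>n\<ge>N. \<exists>a\<in>S n. d l a < e" by blast
      qed
    qed
    moreover have "mtotally_bounded L"
      unfolding mtotally_bounded_def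
    proof (intro allI impI)
      fix e :: real assume e: "e > 0"
      obtain N where N: "\<forall>m\<ge>N. \<forall>n\<ge>N. hausdorff_metric (S m) (S n) < e / 12 / 2"
        using cauchy[of "e/12/2"] e by auto
      then have N1: "\<forall>m\<ge>N. \<forall>n\<ge>N. hausdorff_metric (S m) (S n) < e / 12" using e by fastforce
      obtain F where F: "finite F" "F \<subseteq> S N" "S N \<subseteq> (\<Union>x\<in>F. mball x (e/3))"
        using compactin_imp_mtotally_bounded[OF nonempty_compactsD(2)[OF S[of N]]] e
        unfolding mtotally_bounded_def by (metis divide_pos_pos zero_less_numeral)
      have "\<forall>y\<in>F. \<exists>x\<in>L. d y x < e / 6" using near_L[of "e/12" N _ N] N F e by auto
      then obtain g where g: "\<And>y. y \<in> F \<Longrightarrow> g y \<in> L" "\<And>y. y \<in> F \<Longrightarrow> d y (g y) < e / 6" by metis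
      have "x \<in> (\<Union>y\<in>g ` F. mball y e)" if xL: "x \<in> L" for x
      proof -
        obtain a where a: "a \<in> S N" "d x a < 2 * (e/12)"
          using L_near[of "e/12" N x N] N1 xL e by auto
        then obtain y where y: "y \<in> F" "d y a < e / 3" using F by auto
        have M: "x \<in> M" "a \<in> M" "y \<in> M" "g y \<in> M" using xL a y LM SM F g by blast+
        have "d (g y) x \<le> d y (g y) + (d y a + d x a)"
          using triangle''[of "g y" y x] triangle'[of y a x] M by force
        then have "x \<in> mball (g y) e" using g(2)[OF y(1)] a y M e by auto
        then show ?thesis using y by blast
      qed
      then show "\<exists>K. finite K \<and> K \<subseteq> L \<and> L \<subseteq> (\<Union>x\<in>K. mball x e)"
        using F(1) g(1) by (intro exI[of _ "g ` F"]) blast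
    qed
    ultimately show ?thesis
      using mtotally_bounded_eq_compact_closure_of[OF complete] by (simp add: closure_of_closedin)
  qed
  ultimately have L: "L \<in> nonempty_compacts" unfolding nonempty_compacts_def by blast
  have "limitin hyp.mtopology S L sequentially"
    unfolding hyp.limit_metric_sequentially
  proof (intro conjI L allI impI)
    fix e :: real assume e: "e > 0"
    obtain N where N: "\<forall>m\<ge>N. \<forall>n\<ge>N. hausdorff_metric (S m) (S n) < e / 4 / 2"
      using cauchy[of "e/4/2"] e by auto
    then have N1: "\<forall>m\<ge>N. \<forall>n\<ge>N. hausdorff_metric (S m) (S n) < e / 4" using e by fastforce
    have "S n \<in> nonempty_compacts \<and> hausdorff_metric (S n) L < e" if "n \<ge> N" for n
    proof -
      have "hausdorff_metric (S n) L \<le> 2 * (e/4)"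
      proof (rule hausdorff_metric_le[OF S L])
        show "\<exists>b\<in>L. d a b \<le> 2 * (e/4)" if "a \<in> S n" for a
          using near_L[of "e/4" N a n] N that e \<open>n \<ge> N\<close> by (force simp: less_imp_le)
        show "\<exists>a\<in>S n. d a b \<le> 2 * (e/4)" if "b \<in> L" for b
          using L_near[of "e/4" N b n] N1 that e \<open>n \<ge> N\<close> by (force simp: commute less_imp_le)
      qed
      then show ?thesis using S e by auto
    qed
    then show "\<exists>N. \<forall>n\<ge>N. S n \<in> nonempty_compacts \<and> hausdorff_metric (S n) L < e" by blast
  qed
  then show "\<exists>L. limitin hyp.mtopology S L sequentially" by blast
qed

text \<open>The finite nonempty subsets of a countable dense set are dense, since a compact set has finite
  \<open>\<epsilon>\<close>-nets and each point of a net can be moved into the dense set.\<close>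

lemma separable_space_hausdorff_metric:
  assumes "separable_space mtopology"
  shows "separable_space (Metric_space.mtopology nonempty_compacts hausdorff_metric)"
proof -
  obtain C where C: "countable C" "C \<subseteq> M" "\<And>x e. x \<in> M \<Longrightarrow> e > 0 \<Longrightarrow> \<exists>c\<in>C. d x c < e"
    using assms unfolding separable_space_mtopology_iff by blast
  define \<F> where "\<F> = {F. finite F \<and> F \<subseteq> C \<and> F \<noteq> {}}"
  have "countable \<F>"
    unfolding \<F>_def by (rule countable_subset[OF _ countable_Collect_finite_subset[OF C(1)]]) auto
  moreover have FK: "\<F> \<subseteq> nonempty_compacts"
    using C(2) unfolding \<F>_def nonempty_compacts_def
    by (auto intro!: finite_imp_compactin)
  moreover have "\<exists>F\<in>\<F>. hausdorff_metric A F < e" if A: "A \<in> nonempty_compacts" and e: "e > 0" for A e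
  proof -
    obtain B where B: "finite B" "B \<subseteq> A" "A \<subseteq> (\<Union>x\<in>B. mball x (e/4))"
      using compactin_imp_mtotally_bounded[OF nonempty_compactsD(2)[OF A]] e
      unfolding mtotally_bounded_def by (metis divide_pos_pos zero_less_numeral)
    have AM: "A \<subseteq> M" "A \<noteq> {}" using nonempty_compactsD A by auto
    have "\<exists>c\<in>C. d b c < e / 4" if "b \<in> B" for b
      using C(3)[of b "e/4"] that B(2) AM(1) e by auto
    then obtain g where g: "\<And>b. b \<in> B \<Longrightarrow> g b \<in> C" "\<And>b. b \<in> B \<Longrightarrow> d b (g b) < e / 4" by metis
    have F: "g ` B \<in> \<F>" using B AM g unfolding \<F>_def by auto
    have "hausdorff_metric A (g ` B) \<le> e / 2"
    proof (rule hausdorff_metric_le[OF A])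
      show "g ` B \<in> nonempty_compacts" using F FK by blast
      show "\<exists>b\<in>g ` B. d a b \<le> e / 2" if a: "a \<in> A" for a
      proof -
        obtain b where b: "b \<in> B" "d b a < e / 4" using B a by auto
        have "d a (g b) \<le> d b a + d b (g b)"
          using b a g C(2) AM B by (intro triangle'') blast+
        then show ?thesis using b g(2)[of b] by force
      qed
      show "\<exists>a\<in>A. d a b \<le> e / 2" if "b \<in> g ` B" for b
        using that B g(2) e by (force intro: less_imp_le)
    qed
    then show ?thesis using F e by force
  qed
  ultimately show ?thesis unfolding hyp.separable_space_mtopology_iff by blast
qed

end

section \<open>The maximum metric on the square\<close>

context Metric_space
begin

lemma Metric_space_max_dist: "Metric_space (M \<times> M) (max_dist d)"
proof
  show "max_dist d x z \<le> max_dist d x y + max_dist d y z"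
    if "x \<in> M \<times> M" "y \<in> M \<times> M" "z \<in> M \<times> M" for x y z
    using that triangle[of "fst x" "fst y" "fst z"] triangle[of "snd x" "snd y" "snd z"]
    unfolding max_dist_def by (auto simp: max_def mem_Times_iff)
  show "(max_dist d x y = 0) = (x = y)" if "x \<in> M \<times> M" "y \<in> M \<times> M" for x y
  proof -
    have "max_dist d x y = 0 \<longleftrightarrow> d (fst x) (fst y) = 0 \<and> d (snd x) (snd y) = 0"
      using nonneg[of "fst x" "fst y"] nonneg[of "snd x" "snd y"]
      unfolding max_dist_def by linarith
    then show ?thesis using that by (simp add: mem_Times_iff prod_eq_iff)
  qed
qed (auto simp: max_dist_def commute le_max_iff_disj)

interpretation sq: Metric_space "M \<times> M" "max_dist d"
  by (rule Metric_space_max_dist)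

interpretation pr: Metric_space12 M d M d ..

lemma max_dist_le_prod_dist: "max_dist d p q \<le> prod_dist d d p q"
  using pr.component_le_prod_metric(1)[of "fst p" "fst q" "snd p" "snd q"]
    pr.component_le_prod_metric(2)[of "snd p" "snd q" "fst p" "fst q"]
  by (simp add: max_dist_def)

lemma prod_dist_le_max_dist: "p \<in> M \<times> M \<Longrightarrow> q \<in> M \<times> M \<Longrightarrow> prod_dist d d p q \<le> 2 * max_dist d p q"
  using pr.prod_metric_le_components[of "fst p" "fst q" "snd p" "snd q"]
  by (cases p; cases q) (auto simp: max_dist_def)

text \<open>The maximum metric and the Euclidean product metric \<^const>\<open>prod_dist\<close> differ by at most a factor of
  2, and the latter is known to generate the product topology.\<close>

lemma mtopology_max_dist:
  "Metric_space.mtopology (M \<times> M) (max_dist d) = prod_topology mtopology mtopology"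
proof -
  have "sq.mtopology = pr.Prod_metric.mtopology"
  proof (rule mtopology_eqI[OF sq.Metric_space_axioms pr.Prod_metric.Metric_space_axioms])
    fix x and e :: real assume x: "x \<in> M \<times> M" and "e > 0"
    have "\<forall>y\<in>M \<times> M. max_dist d x y < e/2 \<longrightarrow> prod_dist d d x y < e"
      using prod_dist_le_max_dist[OF x] by fastforce
    with \<open>e > 0\<close> show "\<exists>\<delta>>0. \<forall>y\<in>M \<times> M. max_dist d x y < \<delta> \<longrightarrow> prod_dist d d x y < e"
      by (meson half_gt_zero)
    have "\<forall>y\<in>M \<times> M. prod_dist d d x y < e \<longrightarrow> max_dist d x y < e"
      using max_dist_le_prod_dist[of x] by (meson order_le_less_trans)
    with \<open>e > 0\<close> show "\<exists>\<delta>>0. \<forall>y\<in>M \<times> M. prod_dist d d x y < \<delta> \<longrightarrow> max_dist d x y < e"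
      by blast
  qed
  then show ?thesis by (simp add: pr.mtopology_prod_metric)
qed

lemma mcomplete_max_dist:
  assumes mcomplete
  shows "Metric_space.mcomplete (M \<times> M) (max_dist d)"
  unfolding sq.mcomplete_def
proof (intro allI impI)
  fix \<sigma> :: "nat \<Rightarrow> 'a \<times> 'a" assume \<sigma>: "sq.MCauchy \<sigma>"
  have "d (fst (\<sigma> n)) (fst (\<sigma> m)) \<le> max_dist d (\<sigma> n) (\<sigma> m)"
    "d (snd (\<sigma> n)) (snd (\<sigma> m)) \<le> max_dist d (\<sigma> n) (\<sigma> m)" for m n
    by (auto simp: max_dist_def)
  then have "MCauchy (fst \<circ> \<sigma>)" "MCauchy (snd \<circ> \<sigma>)"
    using \<sigma> unfolding MCauchy_def sq.MCauchy_def
    by (simp_all add: image_subset_iff mem_Times_iff) (meson order_le_less_trans)+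
  then obtain a b where "limitin mtopology (fst \<circ> \<sigma>) a sequentially"
    "limitin mtopology (snd \<circ> \<sigma>) b sequentially"
    using assms unfolding mcomplete_def by blast
  then have "limitin (prod_topology mtopology mtopology) \<sigma> (a, b) sequentially"
    by (simp add: limitin_pairwise)
  then show "\<exists>l. limitin sq.mtopology \<sigma> l sequentially"
    unfolding mtopology_max_dist by blast
qed

lemma separable_space_max_dist:
  assumes "separable_space mtopology"
  shows "separable_space (Metric_space.mtopology (M \<times> M) (max_dist d))"
proof -
  obtain C where C: "countable C" "C \<subseteq> M" "\<And>x e. x \<in> M \<Longrightarrow> e > 0 \<Longrightarrow> \<exists>c\<in>C. d x c < e"
    using assms unfolding separable_space_mtopology_iff by blast
  have "\<exists>c\<in>C \<times> C. max_dist d x c < e" if "x \<in> M \<times> M" "e > 0" for x e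
    using C(3)[of "fst x" e] C(3)[of "snd x" e] that by (auto simp: max_dist_def)
  then show ?thesis
    unfolding sq.separable_space_mtopology_iff
    using C by (intro exI[of _ "C \<times> C"]) blast
qed

end

section \<open>Closed total orders on compact sets\<close>

lemma linear_order_onD:
  assumes "linear_order_on K r"
  shows "r \<subseteq> K \<times> K" "\<And>x. x \<in> K \<Longrightarrow> (x, x) \<in> r"
    "\<And>x y z. (x, y) \<in> r \<Longrightarrow> (y, z) \<in> r \<Longrightarrow> (x, z) \<in> r"
    "\<And>x y. (x, y) \<in> r \<Longrightarrow> (y, x) \<in> r \<Longrightarrow> x = y"
    "\<And>x y. x \<in> K \<Longrightarrow> y \<in> K \<Longrightarrow> (x, y) \<in> r \<or> (y, x) \<in> r"
proof -
  have r: "r \<subseteq> K \<times> K" "refl_on K r" "trans r" "antisym r" "total_on K r"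
    using assms unfolding order_on_defs by auto
  show "r \<subseteq> K \<times> K" by (rule r)
  show refl: "(x, x) \<in> r" if "x \<in> K" for x using r(2) that by (rule refl_onD)
  show "(x, z) \<in> r" if "(x, y) \<in> r" "(y, z) \<in> r" for x y z using r(3) that by (rule transD)
  show "x = y" if "(x, y) \<in> r" "(y, x) \<in> r" for x y using r(4) that by (rule antisymD)
  show "(x, y) \<in> r \<or> (y, x) \<in> r" if "x \<in> K" "y \<in> K" for x y
    using r(5) that refl unfolding total_on_def by (cases "x = y") auto
qed

lemma linear_order_on_finite_max:
  assumes "linear_order_on K r" "finite Z" "Z \<noteq> {}" "Z \<subseteq> K"
  shows "\<exists>m\<in>Z. \<forall>z\<in>Z. (z, m) \<in> r"
  using assms(2,3,4)
proof (induction rule: finite_ne_induct)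
  case (singleton x)
  then show ?case using linear_order_onD(2)[OF assms(1)] by auto
next
  case (insert x F)
  then obtain m where m: "m \<in> F" "\<forall>z\<in>F. (z, m) \<in> r" by auto
  have "x \<in> K" "m \<in> K" using insert m by auto
  show ?case
  proof (cases "(x, m) \<in> r")
    case True
    with m show ?thesis by auto
  next
    case False
    then have "(m, x) \<in> r" using linear_order_onD(5)[OF assms(1) \<open>x \<in> K\<close> \<open>m \<in> K\<close>] by blast
    then have "\<forall>z\<in>insert x F. (z, x) \<in> r"
      using m linear_order_onD(2,3)[OF assms(1)] \<open>x \<in> K\<close> by blast
    then show ?thesis by blast
  qed
qed

lemma linear_order_on_fst_image:
  assumes "linear_order_on K r"
  shows "fst ` r = K"
  using linear_order_onD(1,2)[OF assms] by force

text \<open>The underlying set is the field of the order. Hence mapping a pair to its order, which turns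
  \<^const>\<open>d_part\<close> into a Hausdorff distance, loses no information.\<close>

lemma Ktot_inject:
  assumes "K1 \<in> Ktot X" "K2 \<in> Ktot X" "snd K1 = snd K2"
  shows "K1 = K2"
proof -
  have "fst ` snd K = fst K" if "K \<in> Ktot X" for K
  proof -
    obtain A r where K: "K = (A, r)" by (cases K)
    then have "linear_order_on A r" using that unfolding Ktot_def by simp
    then show ?thesis using linear_order_on_fst_image K by force
  qed
  then show ?thesis using assms by (metis prod_eqI)
qed

context Metric_space
begin

interpretation sq: Metric_space "M \<times> M" "max_dist d"
  rewrites "Metric_space.mtopology (M \<times> M) (max_dist d) = prod_topology mtopology mtopology"
  by (rule Metric_space_max_dist) (rule mtopology_max_dist)

lemma KtotI:
  assumes "linear_order_on K r" "r \<noteq> {}" "compactin (prod_topology mtopology mtopology) r"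
  shows "(K, r) \<in> Ktot mtopology"
proof -
  have "compactin mtopology (fst ` r)"
    using image_compactin[OF assms(3) continuous_map_fst] .
  then have "compactin mtopology K" by (simp add: linear_order_on_fst_image[OF assms(1)])
  moreover have "K \<noteq> {}" using assms(2) linear_order_on_fst_image[OF assms(1)] by auto
  moreover have "closedin (prod_topology mtopology mtopology) r"
    using compactin_imp_closedin[OF sq.Hausdorff_space_mtopology assms(3)] .
  then have "closedin (subtopology (prod_topology mtopology mtopology) (K \<times> K)) r"
    using linear_order_onD(1)[OF assms(1)] closedin_subset_topspace by blast
  ultimately show ?thesis using assms(1) unfolding Ktot_def by simp
qed

lemma KtotD:
  assumes "(K, r) \<in> Ktot mtopology"
  shows "K \<noteq> {}" "compactin mtopology K" "K \<subseteq> M" "linear_order_on K r"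
    "r \<noteq> {}" "compactin (prod_topology mtopology mtopology) r"
    "closedin (prod_topology mtopology mtopology) r" "r \<in> sq.nonempty_compacts"
proof -
  show *: "K \<noteq> {}" "compactin mtopology K" "linear_order_on K r"
    using assms unfolding Ktot_def by auto
  show "K \<subseteq> M" using compactin_subset_topspace[OF *(2)] by simp
  show ne: "r \<noteq> {}" using * linear_order_onD(2)[OF *(3)] by blast
  have KK: "compactin (prod_topology mtopology mtopology) (K \<times> K)"
    using * by (simp add: compactin_Times)
  have "closedin (prod_topology mtopology mtopology) (K \<times> K)"
    using compactin_imp_closedin[OF sq.Hausdorff_space_mtopology KK] .
  then show cl: "closedin (prod_topology mtopology mtopology) r"
    using assms closedin_trans_full unfolding Ktot_def by blast
  show "compactin (prod_topology mtopology mtopology) r"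
    using closed_compactin[OF KK linear_order_onD(1)[OF *(3)] cl] .
  then show "r \<in> sq.nonempty_compacts" using ne by (simp add: sq.nonempty_compacts_def)
qed

text \<open>The order is closed in the square, being closed in the compact square of its field.\<close>

lemma Ktot_memI:
  assumes "(K, r) \<in> Ktot mtopology" "x \<in> M" "y \<in> M"
    and "\<And>e. e > 0 \<Longrightarrow> \<exists>a b. (a, b) \<in> r \<and> d x a < e \<and> d y b < e"
  shows "(x, y) \<in> r"
proof (rule sq.mem_closedI[OF KtotD(7)[OF assms(1)]])
  show "\<exists>p\<in>r. max_dist d (x, y) p < e" if "e > 0" for e
    using assms(4)[OF that] by (force simp: max_dist_def)
qed (use assms in auto)

text \<open>Since the order is total, \<open>(y, x) \<notin> r\<close> says that \<open>x\<close> is strictly below \<open>y\<close>; as the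
  complement of a closed relation, strict order is preserved under small perturbations.\<close>

lemma Ktot_strict_nearby:
  assumes K: "(K, r) \<in> Ktot mtopology" and "x \<in> K" "y \<in> K" "(y, x) \<notin> r"
  obtains e where "e > 0"
    "\<And>a b. a \<in> K \<Longrightarrow> b \<in> K \<Longrightarrow> d x a < e \<Longrightarrow> d y b < e \<Longrightarrow> (b, a) \<notin> r"
  using Ktot_memI[OF K, of y x] assms KtotD(3)[OF K] by blast

lemma Ktot_converse:
  assumes "(K, r) \<in> Ktot mtopology"
  shows "(K, r\<inverse>) \<in> Ktot mtopology"
proof (rule KtotI)
  show "linear_order_on K (r\<inverse>)" using KtotD(4)[OF assms] by simp
  show "r\<inverse> \<noteq> {}" using KtotD(5)[OF assms] by auto
  have "compactin (prod_topology mtopology mtopology) ((\<lambda>p. (snd p, fst p)) ` r)"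
    by (rule image_compactin[OF KtotD(6)[OF assms]])
       (intro continuous_map_pairedI continuous_map_fst continuous_map_snd)
  moreover have "(\<lambda>p. (snd p, fst p)) ` r = r\<inverse>" by force
  ultimately show "compactin (prod_topology mtopology mtopology) (r\<inverse>)" by simp
qed

lemma Ktot_closedin_above:
  assumes "(K, r) \<in> Ktot mtopology" "z \<in> K"
  shows "closedin mtopology {y. (z, y) \<in> r}"
proof -
  have "continuous_map mtopology (prod_topology mtopology mtopology) (\<lambda>y. (z, y))"
    using assms KtotD(3) by (intro continuous_map_pairedI) auto
  then have "closedin mtopology {y \<in> topspace mtopology. (z, y) \<in> r}"
    using closedin_continuous_map_preimage[OF _ KtotD(7)[OF assms(1)]] by blast
  moreover have "{y \<in> topspace mtopology. (z, y) \<in> r} = {y. (z, y) \<in> r}"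
    using KtotD(3)[OF assms(1)] linear_order_onD(1)[OF KtotD(4)[OF assms(1)]] by auto
  ultimately show ?thesis by simp
qed

text \<open>The sets of points of \<open>S\<close> above a given point are closed and, since finite sets have a maximum, have
  the finite intersection property. A point in all of them is a maximum.\<close>

lemma Ktot_max:
  assumes K: "(K, r) \<in> Ktot mtopology" and S: "S \<subseteq> K" "S \<noteq> {}" "compactin mtopology S"
  shows "\<exists>m\<in>S. \<forall>s\<in>S. (s, m) \<in> r"
proof -
  let ?U = "\<lambda>z. {y. (z, y) \<in> r}"
  have "S \<inter> \<Inter>(?U ` S) \<noteq> {}"
  proof -
    have "S \<inter> \<Inter>\<F> \<noteq> {}" if F: "finite \<F>" "\<F> \<subseteq> ?U ` S" for \<F>
    proof -
      obtain Z where Z: "Z \<subseteq> S" "finite Z" "\<F> = ?U ` Z"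
        using finite_subset_image[OF F] by blast
      show ?thesis
      proof (cases "Z = {}")
        case False
        then obtain m where "m \<in> Z" "\<forall>z\<in>Z. (z, m) \<in> r"
          using linear_order_on_finite_max[OF KtotD(4)[OF K] Z(2)] Z(1) S(1) by blast
        then show ?thesis using Z by auto
      qed (use S Z in auto)
    qed
    moreover have "\<forall>C\<in>?U ` S. closedin mtopology C"
      using Ktot_closedin_above[OF K] S(1) by blast
    ultimately show ?thesis using S(3) unfolding compactin_fip by blast
  qed
  then show ?thesis by blast
qed

text \<open>In a linear order the only closed cycles \<open>x \<preceq> y \<preceq> z \<preceq> x\<close> are the constant ones, and for a
  reflexive total relation this single condition is equivalent to antisymmetry (\<open>z = x\<close>) and
  transitivity (a failure of transitivity closes up to such a cycle by totality). A modulus makes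
  the condition quantitative: a cycle that is allowed an error of \<open>\<delta>\<close> at each of its corners has a
  first edge shorter than \<open>\<epsilon>\<close>.\<close>

definition cycle_modulus :: "('a \<times> 'a) set \<Rightarrow> real \<Rightarrow> real \<Rightarrow> bool" where
  "cycle_modulus r \<epsilon> \<delta> \<longleftrightarrow> (\<forall>x x' y y' z z'. (x, y) \<in> r \<and> (y', z) \<in> r \<and> (z', x') \<in> r \<and>
     d x x' < \<delta> \<and> d y y' < \<delta> \<and> d z z' < \<delta> \<longrightarrow> d x y < \<epsilon>)"

lemma cycle_modulus_mono:
  assumes "cycle_modulus r \<epsilon> \<delta>" "\<delta>' \<le> \<delta>"
  shows "cycle_modulus r \<epsilon> \<delta>'"
  unfolding cycle_modulus_def
proof (intro allI impI, elim conjE)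
  fix x x' y y' z z'
  assume "(x, y) \<in> r" "(y', z) \<in> r" "(z', x') \<in> r" "d x x' < \<delta>'" "d y y' < \<delta>'" "d z z' < \<delta>'"
  moreover from this have "d x x' < \<delta>" "d y y' < \<delta>" "d z z' < \<delta>" using assms(2) by linarith+
  ultimately show "d x y < \<epsilon>" using assms(1) unfolding cycle_modulus_def by blast
qed

text \<open>Compactness: cycles with errors tending to 0 and a long first edge would accumulate at an exact
  cycle of \<open>r\<close> with distinct corners.\<close>

lemma Ktot_cycle_modulus:
  assumes K: "(K, r) \<in> Ktot mtopology" and \<epsilon>: "\<epsilon> > 0"
  shows "\<exists>\<delta>>0. cycle_modulus r \<epsilon> \<delta>"
proof (rule ccontr)
  define bad where "bad \<delta> p \<longleftrightarrow> (case p of (x, x', y, y', z, z') \<Rightarrow>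
     (x, y) \<in> r \<and> (y', z) \<in> r \<and> (z', x') \<in> r \<and>
     d x x' < \<delta> \<and> d y y' < \<delta> \<and> d z z' < \<delta> \<and> \<epsilon> \<le> d x y)" for \<delta> p
  note lin = linear_order_onD[OF KtotD(4)[OF K]]
  note KM = KtotD(3)[OF K]
  assume neg: "\<not> ?thesis"
  have "\<exists>p. bad \<delta> p" if "\<delta> > 0" for \<delta>
  proof -
    obtain x x' y y' z z' where "(x, y) \<in> r" "(y', z) \<in> r" "(z', x') \<in> r"
      "d x x' < \<delta>" "d y y' < \<delta>" "d z z' < \<delta>" "\<not> d x y < \<epsilon>"
      using neg \<open>\<delta> > 0\<close> unfolding cycle_modulus_def by blast
    then show ?thesis unfolding bad_def by (intro exI[of _ "(x, x', y, y', z, z')"]) auto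
  qed
  then have "\<forall>n. \<exists>p. bad (inverse (real (Suc n))) p" by simp
  then obtain P where P: "\<And>n. bad (inverse (real (Suc n))) (P n)" by metis
  define x x' y y' z z' where "x n = fst (P n)" and "x' n = fst (snd (P n))"
    and "y n = fst (snd (snd (P n)))" and "y' n = fst (snd (snd (snd (P n))))"
    and "z n = fst (snd (snd (snd (snd (P n)))))" and "z' n = snd (snd (snd (snd (snd (P n)))))" for n
  note defs = this
  have "bad (inverse (real (Suc n))) (x n, x' n, y n, y' n, z n, z' n)" for n
    using P[of n] unfolding defs by simp
  then have xy: "(x n, y n) \<in> r" and yz: "(y' n, z n) \<in> r" and zx: "(z' n, x' n) \<in> r"
    and dx: "d (x n) (x' n) < inverse (real (Suc n))"
    and dy: "d (y n) (y' n) < inverse (real (Suc n))"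
    and dz: "d (z n) (z' n) < inverse (real (Suc n))"
    and far: "\<epsilon> \<le> d (x n) (y n)" for n
    unfolding bad_def by (simp_all del: of_nat_Suc)
  have inK: "x n \<in> K" "x' n \<in> K" "y n \<in> K" "y' n \<in> K" "z n \<in> K" "z' n \<in> K" for n
    using xy[of n] yz[of n] zx[of n] lin(1) by auto
  have inM: "x n \<in> M" "x' n \<in> M" "y n \<in> M" "y' n \<in> M" "z n \<in> M" "z' n \<in> M" for n
    using inK KM by auto
  have sub: "\<exists>l s. l \<in> K \<and> strict_mono s \<and> limitin mtopology (u \<circ> s) l sequentially"
    if "\<And>n. u n \<in> K" for u :: "nat \<Rightarrow> 'a"
    using KtotD(2)[OF K] that unfolding compactin_sequentially by blast
  obtain a s1 where s1: "a \<in> K" "strict_mono s1" "limitin mtopology (x \<circ> s1) a sequentially"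
    using sub[of x] inK by blast
  obtain b s2 where s2: "b \<in> K" "strict_mono s2" "limitin mtopology ((y \<circ> s1) \<circ> s2) b sequentially"
    using sub[of "y \<circ> s1"] inK by auto
  obtain c s3 where s3: "c \<in> K" "strict_mono s3"
      "limitin mtopology ((z \<circ> s1 \<circ> s2) \<circ> s3) c sequentially"
    using sub[of "z \<circ> s1 \<circ> s2"] inK by auto
  define s where "s = s1 \<circ> (s2 \<circ> s3)"
  have s: "strict_mono s" unfolding s_def using s1 s2 s3 by (intro strict_mono_o)
  have "limitin mtopology (x \<circ> s) a sequentially" "limitin mtopology (y \<circ> s) b sequentially"
    using limitin_subsequence[OF _ s1(3), of "s2 \<circ> s3"] limitin_subsequence[OF _ s2(3), of s3] s2 s3
    by (auto simp: s_def strict_mono_o o_assoc)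
  moreover have "limitin mtopology (z \<circ> s) c sequentially"
    using s3(3) by (simp add: s_def o_assoc)
  ultimately have lim: "\<forall>e>0. \<exists>N. \<forall>n\<ge>N. d (x (s n)) a < e" "\<forall>e>0. \<exists>N. \<forall>n\<ge>N. d (y (s n)) b < e"
    "\<forall>e>0. \<exists>N. \<forall>n\<ge>N. d (z (s n)) c < e"
    unfolding limit_metric_sequentially by (auto, metis+)
  have near: "\<exists>n. d (x n) a < e \<and> d (y n) b < e \<and> d (z n) c < e \<and> inverse (real (Suc n)) < e"
    if e: "e > 0" for e
  proof -
    obtain N1 N2 N3 where N: "\<forall>n\<ge>N1. d (x (s n)) a < e" "\<forall>n\<ge>N2. d (y (s n)) b < e"
      "\<forall>n\<ge>N3. d (z (s n)) c < e" using lim e by metis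
    obtain N4 where N4: "inverse (real (Suc N4)) < e" using reals_Archimedean[OF e] by blast
    define n where "n = N1 + N2 + N3 + N4"
    have "N4 \<le> s n" using seq_suble[OF s, of n] unfolding n_def by linarith
    then have "inverse (real (Suc (s n))) \<le> inverse (real (Suc N4))" by simp
    with N4 have "inverse (real (Suc (s n))) < e" by linarith
    moreover have "n \<ge> N1" "n \<ge> N2" "n \<ge> N3" unfolding n_def by auto
    ultimately show ?thesis using N by blast
  qed
  have abcM: "a \<in> M" "b \<in> M" "c \<in> M" using s1 s2 s3 KM by auto
  have "(a, b) \<in> r"
  proof (rule Ktot_memI[OF K abcM(1,2)])
    fix e :: real assume "e > 0"
    then obtain n where "d (x n) a < e" "d (y n) b < e" using near by blast
    then show "\<exists>u v. (u, v) \<in> r \<and> d a u < e \<and> d b v < e"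
      using xy[of n] by (metis commute)
  qed
  have close: "d l (v n) < e" if "d (u n) l < e / 2" "d (u n) (v n) < e / 2"
    "l \<in> M" "u n \<in> M" "v n \<in> M" for u v :: "nat \<Rightarrow> 'a" and l e n
    using triangle''[of l "u n" "v n"] that by simp
  have "(b, c) \<in> r"
  proof (rule Ktot_memI[OF K abcM(2,3)])
    fix e :: real assume "e > 0"
    then obtain n where n: "d (y n) b < e/2" "d (z n) c < e/2" "inverse (real (Suc n)) < e/2"
      using near[of "e/2"] by auto
    then have "d b (y' n) < e" using close[of y n b e y'] dy[of n] inM abcM by auto
    moreover have "d c (z n) < e" using n \<open>e > 0\<close> by (simp add: commute)
    ultimately show "\<exists>u v. (u, v) \<in> r \<and> d b u < e \<and> d c v < e" using yz[of n] by blast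
  qed
  moreover have "(c, a) \<in> r"
  proof (rule Ktot_memI[OF K abcM(3,1)])
    fix e :: real assume "e > 0"
    then obtain n where n: "d (z n) c < e/2" "d (x n) a < e/2" "inverse (real (Suc n)) < e/2"
      using near[of "e/2"] by auto
    then have "d c (z' n) < e" "d a (x' n) < e"
      using close[of z n c e z'] dz[of n] close[of x n a e x'] dx[of n] inM abcM by auto
    then show "\<exists>u v. (u, v) \<in> r \<and> d c u < e \<and> d a v < e" using zx[of n] by blast
  qed
  ultimately have "a = b" using \<open>(a, b) \<in> r\<close> lin(3,4) by blast
  obtain n where "d (x n) a < \<epsilon>/2" "d (y n) b < \<epsilon>/2" using near[of "\<epsilon>/2"] \<epsilon> by auto
  then have "d (x n) (y n) < \<epsilon>"
    using triangle'[of "x n" a "y n"] inM abcM \<open>a = b\<close> by force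
  then show False using far[of n] by simp
qed

section \<open>Monotone correspondences\<close>

text \<open>By totality, a monotonicity violation means that neither \<open>(x', x)\<close> nor \<open>(y, y')\<close> belongs to its
  order, which removes the inequations from the definition.\<close>

lemma monotone_correspondences_iff:
  assumes "(K1, r1) \<in> Ktot mtopology" "(K2, r2) \<in> Ktot mtopology"
  shows "R \<in> monotone_correspondences (K1, r1) (K2, r2) \<longleftrightarrow>
    R \<subseteq> K1 \<times> K2 \<and> (\<forall>x\<in>K1. \<exists>y. (x, y) \<in> R) \<and> (\<forall>y\<in>K2. \<exists>x. (x, y) \<in> R) \<and>
    (\<forall>x y x' y'. (x, y) \<in> R \<longrightarrow> (x', y') \<in> R \<longrightarrow> (x', x) \<in> r1 \<or> (y, y') \<in> r2)"
proof -
  note l1 = linear_order_onD[OF KtotD(4)[OF assms(1)]]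
  note l2 = linear_order_onD[OF KtotD(4)[OF assms(2)]]
  have 1: "(x, x') \<in> r1 \<and> x \<noteq> x' \<longleftrightarrow> (x', x) \<notin> r1" if "x \<in> K1" "x' \<in> K1" for x x'
    using that l1(2,4,5) by metis
  have 2: "(y', y) \<in> r2 \<and> y' \<noteq> y \<longleftrightarrow> (y, y') \<notin> r2" if "y \<in> K2" "y' \<in> K2" for y y'
    using that l2(2,4,5) by metis
  show ?thesis
  proof (cases "R \<subseteq> K1 \<times> K2")
    case True
    have "(\<exists>x1 x2 x1' x2'. (x1, x2) \<in> R \<and> (x1', x2') \<in> R \<and>
        (x1, x1') \<in> r1 \<and> x1 \<noteq> x1' \<and> (x2', x2) \<in> r2 \<and> x2' \<noteq> x2) \<longleftrightarrow>
      \<not> (\<forall>x y x' y'. (x, y) \<in> R \<longrightarrow> (x', y') \<in> R \<longrightarrow> (x', x) \<in> r1 \<or> (y, y') \<in> r2)"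
    proof -
      have "(x1, x1') \<in> r1 \<and> x1 \<noteq> x1' \<and> (x2', x2) \<in> r2 \<and> x2' \<noteq> x2 \<longleftrightarrow>
          \<not> ((x1', x1) \<in> r1 \<or> (x2, x2') \<in> r2)"
        if "(x1, x2) \<in> R" "(x1', x2') \<in> R" for x1 x2 x1' x2'
        using 1[of x1 x1'] 2[of x2 x2'] that True by auto
      then show ?thesis unfolding not_all not_imp by (intro iff_exI) blast
    qed
    moreover have "(\<forall>x\<in>K1. \<exists>y\<in>K2. (x, y) \<in> R) \<longleftrightarrow> (\<forall>x\<in>K1. \<exists>y. (x, y) \<in> R)"
      "(\<forall>y\<in>K2. \<exists>x\<in>K1. (x, y) \<in> R) \<longleftrightarrow> (\<forall>y\<in>K2. \<exists>x. (x, y) \<in> R)" using True by blast+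
    ultimately show ?thesis
      unfolding monotone_correspondences_def mem_Collect_eq fst_conv snd_conv by argo
  qed (auto simp: monotone_correspondences_def)
qed

text \<open>A correspondence \<open>T0\<close> of size at most \<open>c\<close> which is not monotone can be replaced by a monotone one of
  the same size, provided that whenever two of its pairs cross, swapping their second components
  keeps the distances at most \<open>c\<close>.

  Let \<open>T\<close> be the closure of \<open>T0\<close>; as strictness is an open condition, \<open>T\<close> satisfies the same
  hypotheses. Picture \<open>T\<close> as a subset of a rectangle with \<open>K1\<close> as horizontal and \<open>K2\<close> as vertical
  axis. The new correspondence is the upper left staircase of \<open>T\<close>: above \<open>x\<close> it contains the running
  maximum \<open>F\<close> of \<open>T\<close> over the points \<open>\<preceq> x\<close>, and to the left of \<open>y\<close> the running minimum \<open>G\<close> of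
  \<open>T\<close> over the points \<open>\<succeq> y\<close>. Both exist by compactness. Every point of the staircase has a point of
  \<open>T\<close> weakly to its upper left, but no point of \<open>T\<close> strictly to its upper left; two crossing points
  of the staircase would contradict this. If \<open>(x, y)\<close> lies on the staircase because of a point
  \<open>(x', y)\<close> of \<open>T\<close> to its left, and \<open>(x, y0)\<close> is any partner of \<open>x\<close> in \<open>T\<close>, then \<open>y0\<close> lies
  weakly below \<open>y\<close>, so these two points of \<open>T\<close> cross weakly and the swapping hypothesis bounds the
  distance of \<open>x\<close> and \<open>y\<close>.\<close>

lemma staircase_correspondence:
  assumes K1: "(K1, r1) \<in> Ktot mtopology" and K2: "(K2, r2) \<in> Ktot mtopology"
    and T0: "T0 \<subseteq> K1 \<times> K2" "\<And>x. x \<in> K1 \<Longrightarrow> \<exists>y. (x, y) \<in> T0" "\<And>y. y \<in> K2 \<Longrightarrow> \<exists>x. (x, y) \<in> T0"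
    and T0_le: "\<And>x y. (x, y) \<in> T0 \<Longrightarrow> d x y \<le> c"
    and T0_viol: "\<And>x y x' y'. (x, y) \<in> T0 \<Longrightarrow> (x', y') \<in> T0 \<Longrightarrow> (x', x) \<notin> r1 \<Longrightarrow> (y, y') \<notin> r2 \<Longrightarrow>
       d x y' \<le> c \<and> d x' y \<le> c"
  shows "\<exists>R\<in>monotone_correspondences (K1, r1) (K2, r2). \<forall>(x, y)\<in>R. d x y \<le> c"
proof -
  let ?X2 = "prod_topology mtopology mtopology"
  note l1 = linear_order_onD[OF KtotD(4)[OF K1]]
  note l2 = linear_order_onD[OF KtotD(4)[OF K2]]
  note KM1 = KtotD(3)[OF K1]
  note KM2 = KtotD(3)[OF K2]
  define T where "T = ?X2 closure_of T0"
  have cT: "closedin ?X2 T" unfolding T_def by simp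
  have T0T: "T0 \<subseteq> T" unfolding T_def using T0(1) KM1 KM2 by (intro closure_of_subset) auto
  have KK: "compactin ?X2 (K1 \<times> K2)" using KtotD(2) K1 K2 by (simp add: compactin_Times)
  have TK: "T \<subseteq> K1 \<times> K2"
    unfolding T_def
    by (rule closure_of_minimal[OF T0(1) compactin_imp_closedin[OF sq.Hausdorff_space_mtopology KK]])
  have near: "\<exists>a b. (a, b) \<in> T0 \<and> d x a < e \<and> d y b < e" if "(x, y) \<in> T" "e > 0" for x y e
    using that unfolding T_def sq.metric_closure_of by (force simp: max_dist_def)
  have limit: "d x y \<le> c"
    if lim: "\<And>e. e > 0 \<Longrightarrow> \<exists>a b. d x a < e \<and> d y b < e \<and> d a b \<le> c \<and> a \<in> M \<and> b \<in> M"
      and xy: "x \<in> M" "y \<in> M"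
    for x y
  proof (rule field_le_epsilon)
    fix e :: real assume "e > 0"
    then obtain a b where ab: "d x a < e/2" "d y b < e/2" "d a b \<le> c" "a \<in> M" "b \<in> M"
      using lim[of "e/2"] by auto
    then show "d x y \<le> c + e" using triangle[of x a y] triangle'[of a y b] triangle[of a b y] commute[of y b] xy
      by linarith
  qed
  have TM: "x \<in> M" "y \<in> M" "x \<in> K1" "y \<in> K2" if "(x, y) \<in> T" for x y
    using that TK KM1 KM2 by auto
  have T_le: "d x y \<le> c" if "(x, y) \<in> T" for x y
  proof (rule limit[OF _ TM(1,2)[OF that]])
    fix e :: real assume "e > 0"
    then obtain a b where "(a, b) \<in> T0" "d x a < e" "d y b < e" using near \<open>(x, y) \<in> T\<close> by blast
    then show "\<exists>a b. d x a < e \<and> d y b < e \<and> d a b \<le> c \<and> a \<in> M \<and> b \<in> M"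
      using T0_le T0T TM by blast
  qed
  have T_strict: "d x y' \<le> c \<and> d x' y \<le> c"
    if xy: "(x, y) \<in> T" "(x', y') \<in> T" and viol: "(x', x) \<notin> r1" "(y, y') \<notin> r2" for x y x' y'
  proof -
    obtain e1 where e1: "e1 > 0"
      "\<And>a a'. a \<in> K1 \<Longrightarrow> a' \<in> K1 \<Longrightarrow> d x a < e1 \<Longrightarrow> d x' a' < e1 \<Longrightarrow> (a', a) \<notin> r1"
      using Ktot_strict_nearby[OF K1 TM(3)[OF xy(1)] TM(3)[OF xy(2)] viol(1)] by metis
    obtain e2 where e2: "e2 > 0"
      "\<And>b' b. b' \<in> K2 \<Longrightarrow> b \<in> K2 \<Longrightarrow> d y' b' < e2 \<Longrightarrow> d y b < e2 \<Longrightarrow> (b, b') \<notin> r2"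
      using Ktot_strict_nearby[OF K2 TM(4)[OF xy(2)] TM(4)[OF xy(1)] viol(2)] by metis
    have "\<exists>a b a' b'. d x a < e \<and> d y b < e \<and> d x' a' < e \<and> d y' b' < e \<and>
        d a b' \<le> c \<and> d a' b \<le> c \<and> a \<in> M \<and> b \<in> M \<and> a' \<in> M \<and> b' \<in> M" if "e > 0" for e
    proof -
      define f where "f = min e (min e1 e2)"
      have f: "f > 0" "f \<le> e" "f \<le> e1" "f \<le> e2" unfolding f_def using \<open>e > 0\<close> e1 e2 by auto
      obtain a b where ab: "(a, b) \<in> T0" "d x a < f" "d y b < f" using near[OF xy(1) f(1)] by blast
      obtain a' b' where ab': "(a', b') \<in> T0" "d x' a' < f" "d y' b' < f"
        using near[OF xy(2) f(1)] by blast
      have mem: "a \<in> K1" "a' \<in> K1" "b \<in> K2" "b' \<in> K2" using ab(1) ab'(1) T0(1) by auto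
      then have "(a', a) \<notin> r1" "(b, b') \<notin> r2" using e1(2) e2(2) ab ab' f by auto
      then have "d a b' \<le> c \<and> d a' b \<le> c" using T0_viol[OF ab(1) ab'(1)] by blast
      moreover have "d x a < e" "d y b < e" "d x' a' < e" "d y' b' < e" using ab ab' f by auto
      ultimately show ?thesis using mem KM1 KM2 by blast
    qed
    then show ?thesis using limit[of x y'] limit[of x' y] TM xy by metis
  qed
  have T_weak: "d x y' \<le> c \<and> d x' y \<le> c"
    if "(x, y) \<in> T" "(x', y') \<in> T" "(x, x') \<in> r1" "(y', y) \<in> r2" for x y x' y'
  proof (cases "x = x' \<or> y = y'")
    case True
    then show ?thesis using T_le that by blast
  next
    case False
    then have "(x', x) \<notin> r1" "(y, y') \<notin> r2" using that l1(4) l2(4) by blast+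
    then show ?thesis using T_strict that by blast
  qed
  \<comment> \<open>\<open>F x y\<close>: the height \<open>y\<close> is the maximum of \<open>T\<close> over \<open>{x'. x' \<preceq> x}\<close>;
    \<open>G x y\<close>: the abscissa \<open>x\<close> is the minimum of \<open>T\<close> over the heights \<open>\<succeq> y\<close>.\<close>
  define F where "F x y \<longleftrightarrow> x \<in> K1 \<and> (\<exists>x'. (x', x) \<in> r1 \<and> (x', y) \<in> T) \<and>
    (\<forall>x'' y''. (x'', y'') \<in> T \<and> (x'', x) \<in> r1 \<longrightarrow> (y'', y) \<in> r2)" for x y
  define G where "G x y \<longleftrightarrow> y \<in> K2 \<and> (\<exists>y'. (y, y') \<in> r2 \<and> (x, y') \<in> T) \<and>
    (\<forall>x'' y''. (x'', y'') \<in> T \<and> (y, y'') \<in> r2 \<longrightarrow> (x, x'') \<in> r1)" for x y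
  define R where "R = {(x, y). F x y \<or> G x y}"
  have F_ex: "\<exists>y. F x y" if x: "x \<in> K1" for x
  proof -
    let ?D = "{x'. (x', x) \<in> r1}"
    have "closedin mtopology ?D" using Ktot_closedin_above[OF Ktot_converse[OF K1] x] by simp
    then have "compactin mtopology ?D"
      using l1(1) by (intro closed_compactin[OF KtotD(2)[OF K1]]) auto
    then have "compactin ?X2 (?D \<times> K2)" using KtotD(2)[OF K2] by (simp add: compactin_Times)
    then have "compactin mtopology (snd ` ((?D \<times> K2) \<inter> T))"
      using image_compactin[OF compact_Int_closedin[OF _ cT] continuous_map_snd] by blast
    moreover have A: "snd ` ((?D \<times> K2) \<inter> T) = {y. \<exists>x'. (x', x) \<in> r1 \<and> (x', y) \<in> T}"
      using TM(4) by force
    moreover have "{y. \<exists>x'. (x', x) \<in> r1 \<and> (x', y) \<in> T} \<noteq> {}"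
      using T0(2)[OF x] T0T l1(2)[OF x] by blast
    moreover have "{y. \<exists>x'. (x', x) \<in> r1 \<and> (x', y) \<in> T} \<subseteq> K2" using TM(4) by blast
    ultimately have "\<exists>y\<in>{y. \<exists>x'. (x', x) \<in> r1 \<and> (x', y) \<in> T}.
        \<forall>y'\<in>{y. \<exists>x'. (x', x) \<in> r1 \<and> (x', y) \<in> T}. (y', y) \<in> r2"
      by (intro Ktot_max[OF K2]) simp_all
    then obtain y where "F x y" unfolding F_def using x by blast
    then show ?thesis ..
  qed
  have G_ex: "\<exists>x. G x y" if y: "y \<in> K2" for y
  proof -
    let ?D = "{y'. (y, y') \<in> r2}"
    have "closedin mtopology ?D" using Ktot_closedin_above[OF K2 y] .
    then have "compactin mtopology ?D"
      using l2(1) by (intro closed_compactin[OF KtotD(2)[OF K2]]) auto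
    then have "compactin ?X2 (K1 \<times> ?D)" using KtotD(2)[OF K1] by (simp add: compactin_Times)
    then have "compactin mtopology (fst ` ((K1 \<times> ?D) \<inter> T))"
      using image_compactin[OF compact_Int_closedin[OF _ cT] continuous_map_fst] by blast
    moreover have A: "fst ` ((K1 \<times> ?D) \<inter> T) = {x. \<exists>y'. (y, y') \<in> r2 \<and> (x, y') \<in> T}"
      using TM(3) by force
    moreover have "{x. \<exists>y'. (y, y') \<in> r2 \<and> (x, y') \<in> T} \<noteq> {}"
      using T0(3)[OF y] T0T l2(2)[OF y] by blast
    moreover have "{x. \<exists>y'. (y, y') \<in> r2 \<and> (x, y') \<in> T} \<subseteq> K1" using TM(3) by blast
    ultimately have "\<exists>x\<in>{x. \<exists>y'. (y, y') \<in> r2 \<and> (x, y') \<in> T}.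
        \<forall>x'\<in>{x. \<exists>y'. (y, y') \<in> r2 \<and> (x, y') \<in> T}. (x', x) \<in> r1\<inverse>"
      by (intro Ktot_max[OF Ktot_converse[OF K1]]) simp_all
    then obtain x where "G x y" unfolding G_def using y by blast
    then show ?thesis ..
  qed
  have RK: "(x, y) \<in> R \<Longrightarrow> x \<in> K1 \<and> y \<in> K2" for x y
    unfolding R_def F_def G_def using TM by blast
  have R_below: "\<exists>p q. (p, q) \<in> T \<and> (p, x) \<in> r1 \<and> (y, q) \<in> r2" if "(x, y) \<in> R" for x y
    using that RK[OF that] l1(2) l2(2) unfolding R_def F_def G_def by blast
  have mono: "(x', x) \<in> r1 \<or> (y, y') \<in> r2" if xy: "(x, y) \<in> R" and xy': "(x', y') \<in> R" for x y x' y'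
  proof (rule ccontr)
    assume neg: "\<not> ?thesis"
    obtain p q where pq: "(p, q) \<in> T" "(p, x) \<in> r1" "(y, q) \<in> r2" using R_below[OF xy] by blast
    have "(x, x') \<in> r1" "(y', y) \<in> r2" using neg RK[OF xy] RK[OF xy'] l1(5) l2(5) by blast+
    then have "(p, x') \<in> r1" "(y', q) \<in> r2" using pq l1(3) l2(3) by blast+
    moreover from xy' have "F x' y' \<or> G x' y'" unfolding R_def by simp
    ultimately have "(q, y') \<in> r2 \<or> (x', p) \<in> r1" using pq(1) unfolding F_def G_def by blast
    then show False using neg pq l1(3) l2(3) by blast
  qed
  have "d x y \<le> c" if xy: "(x, y) \<in> R" for x y
  proof -
    obtain y0 where y0: "(x, y0) \<in> T" using T0(2) T0T RK[OF xy] by blast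
    obtain x0 where x0: "(x0, y) \<in> T" using T0(3) T0T RK[OF xy] by blast
    from xy consider "F x y" | "G x y" unfolding R_def by blast
    then show ?thesis
    proof cases
      case 1
      then obtain x' where "(x', x) \<in> r1" "(x', y) \<in> T" "(y0, y) \<in> r2"
        using y0 l1(2) unfolding F_def by blast
      then show ?thesis using T_weak y0 by blast
    next
      case 2
      then obtain y' where "(y, y') \<in> r2" "(x, y') \<in> T" "(x, x0) \<in> r1"
        using x0 l2(2) unfolding G_def by blast
      then show ?thesis using T_weak x0 by blast
    qed
  qed
  moreover have "R \<in> monotone_correspondences (K1, r1) (K2, r2)"
    unfolding monotone_correspondences_iff[OF K1 K2]
    using F_ex G_ex RK mono unfolding R_def by blast
  ultimately show ?thesis by blast
qed

end

section \<open>The two metrics\<close>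

context Metric_space
begin

interpretation sq: Metric_space "M \<times> M" "max_dist d"
  rewrites "Metric_space.mtopology (M \<times> M) (max_dist d) = prod_topology mtopology mtopology"
  by (rule Metric_space_max_dist) (rule mtopology_max_dist)

interpretation hyp: Metric_space sq.nonempty_compacts sq.hausdorff_metric
  by (rule sq.Metric_space_hausdorff_metric)

lemma d_part_eq_hausdorff_metric:
  assumes "K1 \<in> Ktot mtopology" "K2 \<in> Ktot mtopology"
  shows "d_part mtopology d K1 K2 = sq.hausdorff_metric (snd K1) (snd K2)"
  using assms KtotD(8)[of "fst K1" "snd K1"] KtotD(8)[of "fst K2" "snd K2"]
  by (simp add: d_part_def sq.hausdorff_metric_def)

lemma Metric_space_d_part: "Metric_space (Ktot mtopology) (d_part mtopology d)"
proof
  have N: "snd K \<in> sq.nonempty_compacts" if "K \<in> Ktot mtopology" for K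
    using that KtotD(8)[of "fst K" "snd K"] by simp
  have eq: "d_part mtopology d K1 K2 =
      (if K1 \<in> Ktot mtopology \<and> K2 \<in> Ktot mtopology then sq.hausdorff_metric (snd K1) (snd K2) else 0)"
    for K1 K2
    using d_part_eq_hausdorff_metric by (auto simp: d_part_def)
  show "0 \<le> d_part mtopology d K1 K2" for K1 K2 by (simp add: eq)
  show "d_part mtopology d K1 K2 = d_part mtopology d K2 K1" for K1 K2
    by (simp add: eq hyp.commute)
  show "(d_part mtopology d K1 K2 = 0) = (K1 = K2)"
    if "K1 \<in> Ktot mtopology" "K2 \<in> Ktot mtopology" for K1 K2
    using that N Ktot_inject[OF that] by (auto simp: eq)
  show "d_part mtopology d K1 K3 \<le> d_part mtopology d K1 K2 + d_part mtopology d K2 K3"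
    if "K1 \<in> Ktot mtopology" "K2 \<in> Ktot mtopology" "K3 \<in> Ktot mtopology" for K1 K2 K3
    using that N hyp.triangle by (simp add: eq)
qed

lemma d_part_le:
  assumes K1: "(K1, r1) \<in> Ktot mtopology" and K2: "(K2, r2) \<in> Ktot mtopology"
    and "\<And>x x'. (x, x') \<in> r1 \<Longrightarrow> \<exists>y y'. (y, y') \<in> r2 \<and> d x y \<le> c \<and> d x' y' \<le> c"
    and "\<And>y y'. (y, y') \<in> r2 \<Longrightarrow> \<exists>x x'. (x, x') \<in> r1 \<and> d x y \<le> c \<and> d x' y' \<le> c"
  shows "d_part mtopology d (K1, r1) (K2, r2) \<le> c"
proof -
  have "sq.hausdorff_metric r1 r2 \<le> c"
  proof (rule sq.hausdorff_metric_le[OF KtotD(8)[OF K1] KtotD(8)[OF K2]])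
    show "\<exists>q\<in>r2. max_dist d p q \<le> c" if "p \<in> r1" for p
      using assms(3)[of "fst p" "snd p"] that by (force simp: max_dist_def)
    show "\<exists>p\<in>r1. max_dist d p q \<le> c" if "q \<in> r2" for q
      using assms(4)[of "fst q" "snd q"] that by (force simp: max_dist_def)
  qed
  then show ?thesis using d_part_eq_hausdorff_metric[OF K1 K2] by simp
qed

lemma hausdorff_metric_max_dist_lessD:
  assumes "r \<in> sq.nonempty_compacts" "s \<in> sq.nonempty_compacts" "sq.hausdorff_metric r s < c" "(x, x') \<in> r"
  obtains y y' where "(y, y') \<in> s" "d x y < c" "d x' y' < c"
proof -
  obtain q where "q \<in> s" "max_dist d (x, x') q < c"
    using sq.hausdorff_metric_lessD[OF assms] by blast
  then show ?thesis using that[of "fst q" "snd q"] by (auto simp: max_dist_def)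
qed

lemma d_part_lessD:
  assumes K1: "(K1, r1) \<in> Ktot mtopology" and K2: "(K2, r2) \<in> Ktot mtopology"
    and "d_part mtopology d (K1, r1) (K2, r2) < c" "(x, x') \<in> r1"
  obtains y y' where "(y, y') \<in> r2" "d x y < c" "d x' y' < c"
  using hausdorff_metric_max_dist_lessD[OF KtotD(8)[OF K1] KtotD(8)[OF K2], of c x x'] assms
    d_part_eq_hausdorff_metric[OF K1 K2] by auto

lemma Hausdorff_dist_le_d_part:
  assumes K1: "(K1, r1) \<in> Ktot mtopology" and K2: "(K2, r2) \<in> Ktot mtopology"
  shows "Hausdorff_dist d K1 K2 \<le> d_part mtopology d (K1, r1) (K2, r2)"
proof (rule field_le_epsilon)
  fix e :: real assume e: "e > 0"
  interpret dp: Metric_space "Ktot mtopology" "d_part mtopology d" by (rule Metric_space_d_part)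
  note l1 = linear_order_onD[OF KtotD(4)[OF K1]]
  note l2 = linear_order_onD[OF KtotD(4)[OF K2]]
  let ?c = "d_part mtopology d (K1, r1) (K2, r2) + e"
  have lt: "d_part mtopology d (K1, r1) (K2, r2) < ?c" using e by simp
  then have lt': "d_part mtopology d (K2, r2) (K1, r1) < ?c" by (simp add: dp.commute)
  show "Hausdorff_dist d K1 K2 \<le> ?c"
  proof (rule Hausdorff_dist_le[OF KtotD(1)[OF K1] KtotD(1)[OF K2]])
    show "\<exists>y\<in>K2. d x y \<le> ?c" if x: "x \<in> K1" for x
    proof -
      obtain y y' where "(y, y') \<in> r2" "d x y < ?c"
        using d_part_lessD[OF K1 K2 lt l1(2)[OF x]] by metis
      then show ?thesis using l2(1) by (intro bexI[of _ y]) auto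
    qed
    show "\<exists>x\<in>K1. d x y \<le> ?c" if y: "y \<in> K2" for y
    proof -
      obtain x x' where "(x, x') \<in> r1" "d y x < ?c"
        using d_part_lessD[OF K2 K1 lt' l2(2)[OF y]] by metis
      then show ?thesis using l1(1) by (intro bexI[of _ x]) (auto simp: commute)
    qed
  qed
qed

lemma Ktot_pair_bounded:
  assumes K1: "(K1, r1) \<in> Ktot mtopology" and K2: "(K2, r2) \<in> Ktot mtopology"
  obtains C where "\<And>x y. x \<in> K1 \<Longrightarrow> y \<in> K2 \<Longrightarrow> d x y \<le> C"
proof -
  have "mbounded (K1 \<union> K2)"
    using compactin_imp_mbounded KtotD(2) K1 K2 by (simp add: mbounded_Un)
  then show ?thesis using that unfolding mbounded_alt by blast
qed

text \<open>The full product \<open>K1 \<times> K2\<close> satisfies the swapping hypothesis of the staircase construction for any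
  bound of the distances. Hence the infimum in \<^const>\<open>d_tot\<close> is over a nonempty set.\<close>

lemma monotone_correspondences_nonempty:
  assumes K1: "(K1, r1) \<in> Ktot mtopology" and K2: "(K2, r2) \<in> Ktot mtopology"
  shows "monotone_correspondences (K1, r1) (K2, r2) \<noteq> {}"
proof -
  obtain C where C: "\<And>x y. x \<in> K1 \<Longrightarrow> y \<in> K2 \<Longrightarrow> d x y \<le> C"
    using Ktot_pair_bounded[OF K1 K2] by blast
  show ?thesis
    using staircase_correspondence[OF K1 K2, of "K1 \<times> K2" C] C KtotD(1)[OF K1] KtotD(1)[OF K2]
    by blast
qed

lemma monotone_correspondences_mem_nonempty:
  assumes "(K1, r1) \<in> Ktot mtopology" "R \<in> monotone_correspondences (K1, r1) (K2, r2)"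
  shows "R \<noteq> {}"
  using KtotD(1)[OF assms(1)] assms(2) unfolding monotone_correspondences_def by auto

lemma d_tot_le:
  assumes K1: "(K1, r1) \<in> Ktot mtopology" and K2: "(K2, r2) \<in> Ktot mtopology"
    and R: "R \<in> monotone_correspondences (K1, r1) (K2, r2)" "\<And>x y. (x, y) \<in> R \<Longrightarrow> d x y \<le> c"
  shows "d_tot mtopology d (K1, r1) (K2, r2) \<le> c"
proof -
  obtain C where C: "\<And>x y. x \<in> K1 \<Longrightarrow> y \<in> K2 \<Longrightarrow> d x y \<le> C"
    using Ktot_pair_bounded[OF K1 K2] by blast
  have "(INF R\<in>monotone_correspondences (K1, r1) (K2, r2). SUP (x, y)\<in>R. d x y) \<le> c"
  proof (rule cINF_lower2[OF _ R(1)])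
    show "bdd_below ((\<lambda>R. SUP (x, y)\<in>R. d x y) ` monotone_correspondences (K1, r1) (K2, r2))"
    proof (rule bdd_belowI2)
      fix S assume S: "S \<in> monotone_correspondences (K1, r1) (K2, r2)"
      obtain x y where xy: "(x, y) \<in> S"
        using monotone_correspondences_mem_nonempty[OF K1 S] by auto
      have "bdd_above ((\<lambda>(x, y). d x y) ` S)"
        using S C unfolding monotone_correspondences_def by (intro bdd_aboveI2[of _ _ C]) auto
      then have "(case (x, y) of (x, y) \<Rightarrow> d x y) \<le> (SUP (x, y)\<in>S. d x y)"
        using xy by (intro cSUP_upper)
      then show "0 \<le> (SUP (x, y)\<in>S. d x y)" using order_trans[OF nonneg[of x y]] by simp
    qed
    show "(SUP (x, y)\<in>R. d x y) \<le> c"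
      using R(2) monotone_correspondences_mem_nonempty[OF K1 R(1)] by (intro cSUP_least) auto
  qed
  then show ?thesis using K1 K2 by (simp add: d_tot_def)
qed

lemma d_tot_lessD:
  assumes K1: "(K1, r1) \<in> Ktot mtopology" and K2: "(K2, r2) \<in> Ktot mtopology"
    and "d_tot mtopology d (K1, r1) (K2, r2) < c"
  obtains R where "R \<in> monotone_correspondences (K1, r1) (K2, r2)" "\<And>x y. (x, y) \<in> R \<Longrightarrow> d x y < c"
proof -
  obtain C where C: "\<And>x y. x \<in> K1 \<Longrightarrow> y \<in> K2 \<Longrightarrow> d x y \<le> C"
    using Ktot_pair_bounded[OF K1 K2] by blast
  have "(INF R\<in>monotone_correspondences (K1, r1) (K2, r2). SUP (x, y)\<in>R. d x y) < c"
    using assms by (simp add: d_tot_def)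
  then have "\<exists>v\<in>(\<lambda>R. SUP (x, y)\<in>R. d x y) ` monotone_correspondences (K1, r1) (K2, r2). v < c"
    using monotone_correspondences_nonempty[OF K1 K2] by (intro cInf_lessD) auto
  then obtain R where R: "R \<in> monotone_correspondences (K1, r1) (K2, r2)" "(SUP (x, y)\<in>R. d x y) < c"
    by auto
  have "bdd_above ((\<lambda>(x, y). d x y) ` R)"
    using R(1) C unfolding monotone_correspondences_def by (intro bdd_aboveI2[of _ _ C]) auto
  then have "(case p of (x, y) \<Rightarrow> d x y) \<le> (SUP (x, y)\<in>R. d x y)" if "p \<in> R" for p
    using that by (intro cSUP_upper)
  then have "d x y < c" if "(x, y) \<in> R" for x y using that R(2) by fastforce
  with R(1) show ?thesis by (rule that)
qed

text \<open>A monotone correspondence matches \<open>x \<prec> x'\<close> with \<open>y \<preceq> y'\<close>, and for \<open>x = x'\<close> one may take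
  \<open>y = y'\<close>; so pairs in one order have nearby pairs in the other.\<close>

lemma d_part_le_d_tot:
  assumes K1: "(K1, r1) \<in> Ktot mtopology" and K2: "(K2, r2) \<in> Ktot mtopology"
  shows "d_part mtopology d (K1, r1) (K2, r2) \<le> d_tot mtopology d (K1, r1) (K2, r2)"
proof (rule field_le_epsilon)
  fix e :: real assume e: "e > 0"
  note l1 = linear_order_onD[OF KtotD(4)[OF K1]]
  note l2 = linear_order_onD[OF KtotD(4)[OF K2]]
  let ?c = "d_tot mtopology d (K1, r1) (K2, r2) + e"
  obtain R where "R \<in> monotone_correspondences (K1, r1) (K2, r2)"
    and le: "\<And>x y. (x, y) \<in> R \<Longrightarrow> d x y < ?c"
    using d_tot_lessD[OF K1 K2, of ?c] e by auto
  then have R: "R \<subseteq> K1 \<times> K2" "\<And>x. x \<in> K1 \<Longrightarrow> \<exists>y. (x, y) \<in> R" "\<And>y. y \<in> K2 \<Longrightarrow> \<exists>x. (x, y) \<in> R"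
    "\<And>x y x' y'. (x, y) \<in> R \<Longrightarrow> (x', y') \<in> R \<Longrightarrow> (x', x) \<in> r1 \<or> (y, y') \<in> r2"
    using monotone_correspondences_iff[OF K1 K2, of R] by blast+
  show "d_part mtopology d (K1, r1) (K2, r2) \<le> ?c"
  proof (rule d_part_le[OF K1 K2])
    show "\<exists>y y'. (y, y') \<in> r2 \<and> d x y \<le> ?c \<and> d x' y' \<le> ?c" if xx: "(x, x') \<in> r1" for x x'
    proof -
      obtain y y' where y: "(x, y) \<in> R" "(x', y') \<in> R" using R(2) xx l1(1) by blast
      have "(y, y') \<in> r2 \<or> x = x'" using R(4)[OF y] xx l1(4) by blast
      moreover have "(y, y) \<in> r2" using y R(1) l2(2) by blast
      ultimately show ?thesis using y le by (meson less_imp_le)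
    qed
    show "\<exists>x x'. (x, x') \<in> r1 \<and> d x y \<le> ?c \<and> d x' y' \<le> ?c" if yy: "(y, y') \<in> r2" for y y'
    proof -
      obtain x x' where x: "(x, y) \<in> R" "(x', y') \<in> R" using R(3) yy l2(1) by blast
      have "(x, x') \<in> r1 \<or> y = y'" using R(4)[OF x(2) x(1)] yy l2(4) by blast
      moreover have "(x, x) \<in> r1" using x R(1) l1(2) by blast
      ultimately show ?thesis using x le by (meson less_imp_le)
    qed
  qed
qed

lemma d_tot_commute: "d_tot mtopology d K1 K2 = d_tot mtopology d K2 K1"
proof -
  have le: "d_tot mtopology d (K1, r1) (K2, r2) \<le> d_tot mtopology d (K2, r2) (K1, r1)"
    if K1: "(K1, r1) \<in> Ktot mtopology" and K2: "(K2, r2) \<in> Ktot mtopology" for K1 r1 K2 r2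
  proof (rule field_le_epsilon)
    fix e :: real assume "e > 0"
    then obtain R where R: "R \<in> monotone_correspondences (K2, r2) (K1, r1)"
      "\<And>x y. (x, y) \<in> R \<Longrightarrow> d x y < d_tot mtopology d (K2, r2) (K1, r1) + e"
      using d_tot_lessD[OF K2 K1, of "d_tot mtopology d (K2, r2) (K1, r1) + e"] by auto
    have "R\<inverse> \<in> monotone_correspondences (K1, r1) (K2, r2)"
      using R(1) unfolding monotone_correspondences_iff[OF K1 K2] monotone_correspondences_iff[OF K2 K1]
      by blast
    then show "d_tot mtopology d (K1, r1) (K2, r2) \<le> d_tot mtopology d (K2, r2) (K1, r1) + e"
    proof (rule d_tot_le[OF K1 K2])
      show "d x y \<le> d_tot mtopology d (K2, r2) (K1, r1) + e" if "(x, y) \<in> R\<inverse>" for x y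
        using R(2)[of y x] that by (simp add: commute)
    qed
  qed
  show ?thesis
  proof (cases "K1 \<in> Ktot mtopology \<and> K2 \<in> Ktot mtopology")
    case True
    then show ?thesis
      using le[of "fst K1" "snd K1" "fst K2" "snd K2"] le[of "fst K2" "snd K2" "fst K1" "snd K1"] by simp
  qed (auto simp: d_tot_def)
qed

text \<open>The composition \<open>R O S\<close> of monotone correspondences need not be monotone: a point \<open>y\<close> of the middle
  set contributes the whole rectangle of its partners on both sides. But two pairs can cross
  only inside such a rectangle, and there all distances obey the same bound, so the staircase
  construction repairs the composition without increasing its size.\<close>

lemma d_tot_triangle:
  assumes K1: "(K1, r1) \<in> Ktot mtopology" and K2: "(K2, r2) \<in> Ktot mtopology"
    and K3: "(K3, r3) \<in> Ktot mtopology"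
  shows "d_tot mtopology d (K1, r1) (K3, r3) \<le>
    d_tot mtopology d (K1, r1) (K2, r2) + d_tot mtopology d (K2, r2) (K3, r3)" (is "_ \<le> ?a + ?b")
proof (rule field_le_epsilon)
  fix e :: real assume e: "e > 0"
  obtain R where R0: "R \<in> monotone_correspondences (K1, r1) (K2, r2)"
    and Rle: "\<And>x y. (x, y) \<in> R \<Longrightarrow> d x y < ?a + e/2"
    using d_tot_lessD[OF K1 K2, of "?a + e/2"] e by auto
  obtain S where S0: "S \<in> monotone_correspondences (K2, r2) (K3, r3)"
    and Sle: "\<And>x y. (x, y) \<in> S \<Longrightarrow> d x y < ?b + e/2"
    using d_tot_lessD[OF K2 K3, of "?b + e/2"] e by auto
  from R0 have R: "R \<subseteq> K1 \<times> K2" "\<And>x. x \<in> K1 \<Longrightarrow> \<exists>y. (x, y) \<in> R" "\<And>y. y \<in> K2 \<Longrightarrow> \<exists>x. (x, y) \<in> R"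
    "\<And>x y x' y'. (x, y) \<in> R \<Longrightarrow> (x', y') \<in> R \<Longrightarrow> (x', x) \<in> r1 \<or> (y, y') \<in> r2"
    using monotone_correspondences_iff[OF K1 K2, of R] by blast+
  from S0 have S: "S \<subseteq> K2 \<times> K3" "\<And>x. x \<in> K2 \<Longrightarrow> \<exists>y. (x, y) \<in> S" "\<And>y. y \<in> K3 \<Longrightarrow> \<exists>x. (x, y) \<in> S"
    "\<And>x y x' y'. (x, y) \<in> S \<Longrightarrow> (x', y') \<in> S \<Longrightarrow> (x', x) \<in> r2 \<or> (y, y') \<in> r3"
    using monotone_correspondences_iff[OF K2 K3, of S] by blast+
  have comp: "d x z \<le> ?a + ?b + e" if xz: "(x, z) \<in> R O S" for x z
  proof -
    obtain y where y: "(x, y) \<in> R" "(y, z) \<in> S" using xz by blast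
    then have "d x z \<le> d x y + d y z"
      using R(1) S(1) KtotD(3)[OF K1] KtotD(3)[OF K2] KtotD(3)[OF K3] by (intro triangle) auto
    then show ?thesis using Rle[OF y(1)] Sle[OF y(2)] by linarith
  qed
  have viol: "d x z' \<le> ?a + ?b + e \<and> d x' z \<le> ?a + ?b + e"
    if xz: "(x, z) \<in> R O S" "(x', z') \<in> R O S" and v: "(x', x) \<notin> r1" "(z, z') \<notin> r3" for x z x' z'
  proof -
    obtain y where y: "(x, y) \<in> R" "(y, z) \<in> S" using xz(1) by blast
    obtain y' where y': "(x', y') \<in> R" "(y', z') \<in> S" using xz(2) by blast
    have "y = y'"
      using R(4)[OF y(1) y'(1)] S(4)[OF y(2) y'(2)] v linear_order_onD(4)[OF KtotD(4)[OF K2]] by blast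
    then have "(x, z') \<in> R O S" "(x', z) \<in> R O S" using y y' by blast+
    then show ?thesis using comp by blast
  qed
  have "\<exists>T\<in>monotone_correspondences (K1, r1) (K3, r3). \<forall>(x, z)\<in>T. d x z \<le> ?a + ?b + e"
  proof (rule staircase_correspondence[OF K1 K3, of "R O S"])
    show "R O S \<subseteq> K1 \<times> K3" using R(1) S(1) by blast
    show "\<exists>z. (x, z) \<in> R O S" if "x \<in> K1" for x using R(1) R(2)[OF that] S(2) by blast
    show "\<exists>x. (x, z) \<in> R O S" if "z \<in> K3" for z using S(1) S(3)[OF that] R(3) by blast
  qed (use comp viol in auto)
  then show "d_tot mtopology d (K1, r1) (K3, r3) \<le> ?a + ?b + e"
    using d_tot_le[OF K1 K3] by blast
qed

lemma d_tot_refl: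
  assumes K: "(K, r) \<in> Ktot mtopology"
  shows "d_tot mtopology d (K, r) (K, r) = 0"
proof -
  interpret dp: Metric_space "Ktot mtopology" "d_part mtopology d" by (rule Metric_space_d_part)
  have "Id_on K \<in> monotone_correspondences (K, r) (K, r)"
    unfolding monotone_correspondences_iff[OF K K] using linear_order_onD(5)[OF KtotD(4)[OF K]] by auto
  then have "d_tot mtopology d (K, r) (K, r) \<le> 0"
    using KtotD(3)[OF K] by (intro d_tot_le[OF K K]) auto
  moreover have "0 \<le> d_tot mtopology d (K, r) (K, r)"
    using d_part_le_d_tot[OF K K] K by simp
  ultimately show ?thesis by simp
qed

lemma Metric_space_d_tot: "Metric_space (Ktot mtopology) (d_tot mtopology d)"
proof
  interpret dp: Metric_space "Ktot mtopology" "d_part mtopology d" by (rule Metric_space_d_part)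
  have le: "d_part mtopology d K1 K2 \<le> d_tot mtopology d K1 K2"
    if "K1 \<in> Ktot mtopology" "K2 \<in> Ktot mtopology" for K1 K2
    using d_part_le_d_tot[of "fst K1" "snd K1" "fst K2" "snd K2"] that by simp
  show nn: "0 \<le> d_tot mtopology d K1 K2" for K1 K2
  proof (cases "K1 \<in> Ktot mtopology \<and> K2 \<in> Ktot mtopology")
    case True
    then show ?thesis using le[of K1 K2] dp.nonneg[of K1 K2] by linarith
  qed (auto simp: d_tot_def)
  show "d_tot mtopology d K1 K2 = d_tot mtopology d K2 K1" for K1 K2
    by (rule d_tot_commute)
  show "(d_tot mtopology d K1 K2 = 0) = (K1 = K2)"
    if K: "K1 \<in> Ktot mtopology" "K2 \<in> Ktot mtopology" for K1 K2
  proof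
    assume "d_tot mtopology d K1 K2 = 0"
    then have "d_part mtopology d K1 K2 = 0" using le[OF K] dp.nonneg[of K1 K2] by linarith
    then show "K1 = K2" using K by simp
  next
    assume "K1 = K2"
    then show "d_tot mtopology d K1 K2 = 0" using d_tot_refl[of "fst K1" "snd K1"] K by simp
  qed
  show "d_tot mtopology d K1 K3 \<le> d_tot mtopology d K1 K2 + d_tot mtopology d K2 K3"
    if "K1 \<in> Ktot mtopology" "K2 \<in> Ktot mtopology" "K3 \<in> Ktot mtopology" for K1 K2 K3
    using d_tot_triangle[of "fst K1" "snd K1" "fst K2" "snd K2" "fst K3" "snd K3"] that by simp
qed

text \<open>The correspondence of all pairs at distance less than \<open>\<delta>\<close> is made monotone by the staircase
  construction. If \<open>(x, y)\<close> and \<open>(x', y')\<close> cross, with \<open>x \<prec> x'\<close> and \<open>y' \<prec> y\<close>, then the second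
  relation is shadowed by some \<open>u' \<preceq> u\<close> in \<open>K\<close> near \<open>x'\<close> and \<open>x\<close>, and
  \<open>x \<preceq> x' \<approx> u' \<preceq> u \<approx> x\<close> is a cycle with small errors; so \<open>x\<close> and \<open>x'\<close> are close.\<close>

lemma d_tot_small_if_d_part_small:
  assumes K: "(K, r) \<in> Ktot mtopology" and e: "e > 0"
  shows "\<exists>\<delta>>0. \<forall>L\<in>Ktot mtopology. d_part mtopology d (K, r) L < \<delta> \<longrightarrow> d_tot mtopology d (K, r) L < e"
proof -
  interpret dp: Metric_space "Ktot mtopology" "d_part mtopology d" by (rule Metric_space_d_part)
  note lr = linear_order_onD[OF KtotD(4)[OF K]]
  obtain \<delta>0 where "\<delta>0 > 0" and mod: "\<And>x x' y y' z z'. (x, y) \<in> r \<Longrightarrow> (y', z) \<in> r \<Longrightarrow> (z', x') \<in> r \<Longrightarrow>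
      d x x' < \<delta>0 \<Longrightarrow> d y y' < \<delta>0 \<Longrightarrow> d z z' < \<delta>0 \<Longrightarrow> d x y < e/2"
    using Ktot_cycle_modulus[OF K half_gt_zero[OF e]] unfolding cycle_modulus_def by blast
  \<comment> \<open>Each of \<open>u\<close>, \<open>u'\<close> is reached in two steps of length less than \<open>\<delta>\<close>, hence \<open>\<delta>0/2\<close>;
    with \<open>e/4\<close> the swapped distances stay below \<open>e/2 + e/4\<close>.\<close>
  define \<delta> where "\<delta> = min (\<delta>0/2) (e/4)"
  have \<delta>: "\<delta> > 0" "2 * \<delta> \<le> \<delta>0" "\<delta> \<le> e/4" unfolding \<delta>_def using \<open>\<delta>0 > 0\<close> e by auto
  have "d_tot mtopology d (K, r) (L, s) < e"
    if L: "(L, s) \<in> Ktot mtopology" and less: "d_part mtopology d (K, r) (L, s) < \<delta>" for L s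
  proof -
    note ls = linear_order_onD[OF KtotD(4)[OF L]]
    have less': "d_part mtopology d (L, s) (K, r) < \<delta>" using less by (simp add: dp.commute)
    have KM: "x \<in> M" if "x \<in> K" for x using that KtotD(3)[OF K] by blast
    have LM: "x \<in> M" if "x \<in> L" for x using that KtotD(3)[OF L] by blast
    define T0 where "T0 = {(x, y) \<in> K \<times> L. d x y < \<delta>}"
    have "\<exists>R\<in>monotone_correspondences (K, r) (L, s). \<forall>(x, y)\<in>R. d x y \<le> 3 * e / 4"
    proof (rule staircase_correspondence[OF K L, of T0])
      show "T0 \<subseteq> K \<times> L" unfolding T0_def by blast
      show "\<exists>y. (x, y) \<in> T0" if "x \<in> K" for x
        using d_part_lessD[OF K L less lr(2)[OF that]] that ls(1) unfolding T0_def by blast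
      show "\<exists>x. (x, y) \<in> T0" if "y \<in> L" for y
        using d_part_lessD[OF L K less' ls(2)[OF that]] that lr(1) unfolding T0_def
        by (auto simp: commute)
      show "d x y \<le> 3 * e / 4" if "(x, y) \<in> T0" for x y using that \<delta> e unfolding T0_def by auto
      show "d x y' \<le> 3 * e / 4 \<and> d x' y \<le> 3 * e / 4"
        if xy: "(x, y) \<in> T0" and xy': "(x', y') \<in> T0" and v: "(x', x) \<notin> r" "(y, y') \<notin> s" for x y x' y'
      proof -
        have x: "x \<in> K" "x' \<in> K" "y \<in> L" "y' \<in> L" "d x y < \<delta>" "d x' y' < \<delta>"
          using xy xy' unfolding T0_def by auto
        have "(x, x') \<in> r" "(y', y) \<in> s" using v x lr(5) ls(5) by blast+
        obtain u' u where u: "(u', u) \<in> r" "d y' u' < \<delta>" "d y u < \<delta>"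
          using d_part_lessD[OF L K less' \<open>(y', y) \<in> s\<close>] by blast
        have uK: "u \<in> K" "u' \<in> K" using u lr(1) by auto
        have "d x u < \<delta>0" "d x' u' < \<delta>0"
          using triangle[of x y u] triangle[of x' y' u'] x u uK KM LM \<delta> by fastforce+
        then have "d x x' < e/2"
          using mod[OF \<open>(x, x') \<in> r\<close> u(1) lr(2)[OF uK(1)]] uK KM \<open>\<delta>0 > 0\<close> by simp
        moreover have "d x y' \<le> d x x' + d x' y'" "d x' y \<le> d x x' + d x y"
          using triangle[of x x' y'] triangle''[of x' x y] x KM LM by auto
        ultimately show ?thesis using x \<delta> by linarith
      qed
    qed
    then have "d_tot mtopology d (K, r) (L, s) \<le> 3 * e / 4" using d_tot_le[OF K L] by blast
    then show ?thesis using e by linarith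
  qed
  then show ?thesis using \<delta>(1) by (metis surj_pair)
qed

lemma mtopology_d_part_eq_d_tot:
  "Metric_space.mtopology (Ktot mtopology) (d_part mtopology d) =
   Metric_space.mtopology (Ktot mtopology) (d_tot mtopology d)"
proof (rule mtopology_eqI[OF Metric_space_d_part Metric_space_d_tot])
  fix K and e :: real assume K: "K \<in> Ktot mtopology" and e: "e > 0"
  show "\<exists>\<delta>>0. \<forall>L\<in>Ktot mtopology. d_part mtopology d K L < \<delta> \<longrightarrow> d_tot mtopology d K L < e"
    using d_tot_small_if_d_part_small[of "fst K" "snd K"] K e by simp
  have "d_part mtopology d K L < e" if "L \<in> Ktot mtopology" "d_tot mtopology d K L < e" for L
    using d_part_le_d_tot[of "fst K" "snd K" "fst L" "snd L"] K that by simp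
  then show "\<exists>\<delta>>0. \<forall>L\<in>Ktot mtopology. d_tot mtopology d K L < \<delta> \<longrightarrow> d_part mtopology d K L < e"
    using e by blast
qed

end

lemma d_tot_small_if_equivalent:
  assumes d: "Metric_space M d" "Metric_space.mtopology M d = X"
    and d': "Metric_space M d'" "Metric_space.mtopology M d' = X"
    and "K \<in> Ktot X" "e > 0"
  shows "\<exists>\<delta>>0. \<forall>L\<in>Ktot X. d_tot X d K L < \<delta> \<longrightarrow> d_tot X d' K L < e"
proof -
  interpret m: Metric_space M d by fact
  interpret m': Metric_space M d' by fact
  obtain A r where K: "K = (A, r)" by (cases K)
  note mK = m.KtotD[of A r, unfolded d, OF assms(5)[unfolded K]]
  obtain \<delta> where "\<delta> > 0" and \<delta>: "\<And>x y. x \<in> A \<Longrightarrow> y \<in> M \<Longrightarrow> d x y < \<delta> \<Longrightarrow> d' x y < e/2"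
    using equivalent_metrics_uniform_on_compact[OF d(1) d'(1), of A "e/2"] mK d d' assms(6) by auto
  have "d_tot X d' (A, r) (B, s) < e"
    if L: "(B, s) \<in> Ktot X" and less: "d_tot X d (A, r) (B, s) < \<delta>" for B s
  proof -
    obtain R where R: "R \<in> monotone_correspondences (A, r) (B, s)" "\<And>x y. (x, y) \<in> R \<Longrightarrow> d x y < \<delta>"
      using m.d_tot_lessD[unfolded d, of A r B s \<delta>] assms(5) K L less by blast
    have "R \<subseteq> A \<times> B" using R(1) by (simp add: monotone_correspondences_def)
    moreover have "B \<subseteq> M" using m.KtotD(3)[unfolded d, OF L] .
    ultimately have "d' x y \<le> e/2" if "(x, y) \<in> R" for x y
      using \<delta>[of x y] R(2)[OF that] that by (intro less_imp_le) blast
    then have "d_tot X d' (A, r) (B, s) \<le> e/2"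
      using m'.d_tot_le[unfolded d', of A r B s R "e/2"] assms(5) K L R(1) by blast
    then show ?thesis using assms(6) by linarith
  qed
  then show ?thesis using \<open>\<delta> > 0\<close> unfolding K by (metis surj_pair)
qed

lemma mtopology_d_tot_equivalent:
  assumes "Metric_space M d" "Metric_space.mtopology M d = X"
    and "Metric_space M d'" "Metric_space.mtopology M d' = X"
  shows "Metric_space.mtopology (Ktot X) (d_tot X d) = Metric_space.mtopology (Ktot X) (d_tot X d')"
proof (rule mtopology_eqI)
  show "Metric_space (Ktot X) (d_tot X d)" "Metric_space (Ktot X) (d_tot X d')"
    using Metric_space.Metric_space_d_tot[OF assms(1)] Metric_space.Metric_space_d_tot[OF assms(3)]
      assms(2,4) by simp_all
qed (use d_tot_small_if_equivalent[OF assms] d_tot_small_if_equivalent[OF assms(3,4,1,2)] in auto)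

section \<open>Polishness\<close>

context Metric_space
begin

interpretation sq: Metric_space "M \<times> M" "max_dist d"
  rewrites "Metric_space.mtopology (M \<times> M) (max_dist d) = prod_topology mtopology mtopology"
  by (rule Metric_space_max_dist) (rule mtopology_max_dist)

interpretation hyp: Metric_space sq.nonempty_compacts sq.hausdorff_metric
  by (rule sq.Metric_space_hausdorff_metric)

text \<open>Reflexivity is taken on the field of the relation. Both properties only require that certain pairs
  belong to the relation, and a pair belongs to a closed relation if it is a limit of pairs in
  relations converging to it. Totality is a disjunction, of which one alternative must hold
  arbitrarily close to the limit.\<close>

lemma closedin_reflexive_total:
  "closedin hyp.mtopology {r \<in> sq.nonempty_compacts.
     (\<forall>x y. (x, y) \<in> r \<longrightarrow> (x, x) \<in> r \<and> (y, y) \<in> r) \<and>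
     (\<forall>x y. (x, x) \<in> r \<longrightarrow> (y, y) \<in> r \<longrightarrow> (x, y) \<in> r \<or> (y, x) \<in> r)}" (is "closedin _ ?C")
  unfolding hyp.closedin_metric
proof (intro conjI allI impI)
  show "?C \<subseteq> sq.nonempty_compacts" by blast
  fix r assume r: "r \<in> sq.nonempty_compacts - ?C"
  show "\<exists>e>0. disjnt ?C (hyp.mball r e)"
  proof (rule ccontr)
    assume neg: "\<not> ?thesis"
    define C where "C = ?C"
    have CN: "s \<in> sq.nonempty_compacts"
      and C_refl: "(x, y) \<in> s \<Longrightarrow> (x, x) \<in> s \<and> (y, y) \<in> s"
      and C_total: "(x, x) \<in> s \<Longrightarrow> (y, y) \<in> s \<Longrightarrow> (x, y) \<in> s \<or> (y, x) \<in> s"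
      if "s \<in> C" for s x y
      using that unfolding C_def by blast+
    have rN: "r \<in> sq.nonempty_compacts" using r by blast
    have ap: "\<exists>s\<in>C. sq.hausdorff_metric r s < e" if "e > 0" for e
      using neg that rN CN unfolding disjnt_iff C_def[symmetric] by auto
    have rM: "x \<in> M" "y \<in> M" if "(x, y) \<in> r" for x y
      using sq.nonempty_compactsD(3)[OF rN] that by auto
    have rI: "(x, y) \<in> r"
      if near: "\<And>e. e > 0 \<Longrightarrow> \<exists>a b. (a, b) \<in> r \<and> d x a < e \<and> d y b < e" and xy: "x \<in> M" "y \<in> M" for x y
    proof (rule sq.mem_closedI[OF sq.nonempty_compactsD(5)[OF rN]])
      show "\<exists>p\<in>r. max_dist d (x, y) p < e" if "e > 0" for e
        using near[OF that] by (force simp: max_dist_def)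
    qed (use xy in auto)
    have move: "\<exists>u v. (u, v) \<in> r \<and> d x u < e \<and> d y v < e"
      if s: "s \<in> C" "sq.hausdorff_metric r s < e/2" and ab: "(a, b) \<in> s" "d x a < e/2" "d y b < e/2"
        and xy: "x \<in> M" "y \<in> M" for s a b x y e
    proof -
      have sN: "s \<in> sq.nonempty_compacts" using s CN by blast
      obtain u v where uv: "(u, v) \<in> r" "d a u < e/2" "d b v < e/2"
        using hausdorff_metric_max_dist_lessD[OF sN rN _ ab(1), of "e/2"] s(2)
        by (metis sq.hausdorff_metric_commute)
      have "a \<in> M" "b \<in> M" using sq.nonempty_compactsD(3)[OF sN] ab(1) by auto
      then have "d x u < e" "d y v < e"
        using triangle[of x a u] triangle[of y b v] ab uv xy rM[OF uv(1)] by linarith+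
      then show ?thesis using uv(1) by blast
    qed
    have near: "\<exists>s\<in>C. sq.hausdorff_metric r s < e/2 \<and>
        (\<forall>x y. (x, y) \<in> r \<longrightarrow> (\<exists>a b. (a, b) \<in> s \<and> d x a < e/2 \<and> d y b < e/2))" if e: "e > 0" for e
    proof -
      obtain s where s: "s \<in> C" "sq.hausdorff_metric r s < e/2" using ap[of "e/2"] e by auto
      have sN: "s \<in> sq.nonempty_compacts" using s(1) CN by blast
      have "\<exists>a b. (a, b) \<in> s \<and> d x a < e/2 \<and> d y b < e/2" if "(x, y) \<in> r" for x y
        by (rule hausdorff_metric_max_dist_lessD[OF rN sN s(2) that]) blast
      then show ?thesis using s by blast
    qed
    have refl: "(x, x) \<in> r \<and> (y, y) \<in> r" if xy: "(x, y) \<in> r" for x y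
    proof -
      have "(\<exists>u v. (u, v) \<in> r \<and> d x u < e \<and> d x v < e) \<and> (\<exists>u v. (u, v) \<in> r \<and> d y u < e \<and> d y v < e)"
        if e: "e > 0" for e
      proof -
        obtain s a b where s: "s \<in> C" "sq.hausdorff_metric r s < e/2"
          and ab: "(a, b) \<in> s" "d x a < e/2" "d y b < e/2" using near[OF e] xy by blast
        have "(a, a) \<in> s" "(b, b) \<in> s" using C_refl[OF s(1) ab(1)] by blast+
        then show ?thesis using move[OF s] ab rM[OF xy] by blast
      qed
      then show ?thesis using rI rM[OF xy] by blast
    qed
    have total: "(x, y) \<in> r \<or> (y, x) \<in> r" if xx: "(x, x) \<in> r" and yy: "(y, y) \<in> r" for x y
    proof (rule ccontr)
      assume no: "\<not> ?thesis"
      have M: "x \<in> M" "y \<in> M" using rM xx yy by blast+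
      obtain e1 where e1: "e1 > 0" "\<And>u v. (u, v) \<in> r \<Longrightarrow> d x u < e1 \<Longrightarrow> \<not> d y v < e1"
        using rI[of x y] no M by blast
      obtain e2 where e2: "e2 > 0" "\<And>u v. (u, v) \<in> r \<Longrightarrow> d y u < e2 \<Longrightarrow> \<not> d x v < e2"
        using rI[of y x] no M by blast
      define e where "e = min e1 e2"
      have e: "e > 0" "e \<le> e1" "e \<le> e2" unfolding e_def using e1 e2 by auto
      obtain s where s: "s \<in> C" "sq.hausdorff_metric r s < e/2"
        and sr: "\<And>x y. (x, y) \<in> r \<Longrightarrow> \<exists>a b. (a, b) \<in> s \<and> d x a < e/2 \<and> d y b < e/2"
        using near[OF e(1)] by blast
      obtain a a' where a: "(a, a') \<in> s" "d x a < e/2" using sr[OF xx] by blast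
      obtain b b' where b: "(b, b') \<in> s" "d y b < e/2" using sr[OF yy] by blast
      have "(a, a) \<in> s" "(b, b) \<in> s" using C_refl[OF s(1) a(1)] C_refl[OF s(1) b(1)] by blast+
      then have "(a, b) \<in> s \<or> (b, a) \<in> s" using C_total[OF s(1)] by blast
      then have "(\<exists>u v. (u, v) \<in> r \<and> d x u < e \<and> d y v < e) \<or> (\<exists>u v. (u, v) \<in> r \<and> d y u < e \<and> d x v < e)"
        using move[OF s] a(2) b(2) M by blast
      then show False using e1(2) e2(2) e by force
    qed
    show False using r rN refl total by blast
  qed
qed

text \<open>Among the reflexive total compact relations the linear orders are those whose cycles are constant.
  The set \<open>U n\<close> is a union of open balls around the linear orders \<open>r\<close>, with radii so small that, by a
  modulus of \<open>r\<close>, each relation in the ball has only cycles of size of order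
  \<open>1/n\<close>. So linear orders belong to every \<open>U n\<close>, and a relation in all of them has
  constant cycles only. The set itself is not closed: a limit of linear orders may relate two distinct
  points in both directions.\<close>

lemma gdelta_in_Ktot: "gdelta_in hyp.mtopology (snd ` Ktot mtopology)"
proof -
  define C where "C = {r \<in> sq.nonempty_compacts.
     (\<forall>x y. (x, y) \<in> r \<longrightarrow> (x, x) \<in> r \<and> (y, y) \<in> r) \<and>
     (\<forall>x y. (x, x) \<in> r \<longrightarrow> (y, y) \<in> r \<longrightarrow> (x, y) \<in> r \<or> (y, x) \<in> r)}"
  define U where "U n = \<Union>{hyp.mball r (\<delta>/2) | r \<delta>. r \<in> snd ` Ktot mtopology \<and> 0 < \<delta> \<and>
      \<delta> \<le> inverse (real (Suc n)) \<and> cycle_modulus r (inverse (real (Suc n))) \<delta>}" for n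
  have "gdelta_in hyp.mtopology C"
    using closed_imp_gdelta_in[OF hyp.metrizable_space_mtopology closedin_reflexive_total]
    unfolding C_def .
  moreover have "gdelta_in hyp.mtopology (\<Inter>(range U))"
  proof (intro gdelta_in_Inter)
    fix S assume "S \<in> range U"
    then have "openin hyp.mtopology S" unfolding U_def by auto
    then show "gdelta_in hyp.mtopology S" by (rule open_imp_gdelta_in)
  qed auto
  moreover have "C \<inter> \<Inter>(range U) = snd ` Ktot mtopology"
  proof (intro equalityI subsetI)
    fix r assume "r \<in> snd ` Ktot mtopology"
    then obtain K where K: "(K, r) \<in> Ktot mtopology" by force
    note lin = linear_order_onD[OF KtotD(4)[OF K]]
    have "r \<in> C"
      unfolding C_def using KtotD(8)[OF K] lin(1,2,5) by blast
    moreover have "r \<in> U n" for n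
    proof -
      obtain \<delta> where \<delta>: "\<delta> > 0" "cycle_modulus r (inverse (real (Suc n))) \<delta>"
        using Ktot_cycle_modulus[OF K, of "inverse (real (Suc n))"] by auto
      define \<delta>' where "\<delta>' = min \<delta> (inverse (real (Suc n)))"
      have "\<delta>' > 0" "\<delta>' \<le> inverse (real (Suc n))" "cycle_modulus r (inverse (real (Suc n))) \<delta>'"
        using \<delta> cycle_modulus_mono[OF \<delta>(2), of \<delta>'] unfolding \<delta>'_def by (auto simp del: of_nat_Suc)
      moreover have "r \<in> hyp.mball r (\<delta>'/2)" using \<open>\<delta>' > 0\<close> KtotD(8)[OF K] by simp
      ultimately show ?thesis unfolding U_def using \<open>r \<in> snd ` Ktot mtopology\<close> by blast
    qed
    ultimately show "r \<in> C \<inter> \<Inter>(range U)" by blast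
  next
    fix s assume s: "s \<in> C \<inter> \<Inter>(range U)"
    then have sN: "s \<in> sq.nonempty_compacts"
      and refl: "\<And>x y. (x, y) \<in> s \<Longrightarrow> (x, x) \<in> s \<and> (y, y) \<in> s"
      and total: "\<And>x y. (x, x) \<in> s \<Longrightarrow> (y, y) \<in> s \<Longrightarrow> (x, y) \<in> s \<or> (y, x) \<in> s"
      unfolding C_def by blast+
    have sM: "x \<in> M" "y \<in> M" if "(x, y) \<in> s" for x y
      using sq.nonempty_compactsD(3)[OF sN] that by auto
    \<comment> \<open>The first edge of a cycle in \<open>s\<close> follows, up to errors less than \<open>\<delta>/2\<close> at its two ends,
      an edge shorter than \<open>1/(n + 1)\<close>; as \<open>\<delta> \<le> 1/(n + 1)\<close>, its length is less than \<open>2/(n + 1)\<close>.\<close>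
    have cyc: "x = y" if c: "(x, y) \<in> s" "(y, z) \<in> s" "(z, x) \<in> s" for x y z
    proof (rule ccontr)
      assume "x \<noteq> y"
      then have "d x y / 2 > 0" using sM[OF c(1)] by simp
      then obtain n where n: "inverse (real (Suc n)) < d x y / 2" using reals_Archimedean by blast
      have "s \<in> U n" using s by blast
      then obtain r \<delta> where r: "r \<in> sq.nonempty_compacts" "sq.hausdorff_metric s r < \<delta>/2"
        and \<delta>: "\<delta> > 0" "\<delta> \<le> inverse (real (Suc n))" "cycle_modulus r (inverse (real (Suc n))) \<delta>"
        unfolding U_def using sq.hausdorff_metric_commute by auto
      obtain x1 y1 where 1: "(x1, y1) \<in> r" "d x x1 < \<delta>/2" "d y y1 < \<delta>/2"
        using hausdorff_metric_max_dist_lessD[OF sN r c(1)] by blast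
      obtain y2 z2 where 2: "(y2, z2) \<in> r" "d y y2 < \<delta>/2" "d z z2 < \<delta>/2"
        using hausdorff_metric_max_dist_lessD[OF sN r c(2)] by blast
      obtain z3 x3 where 3: "(z3, x3) \<in> r" "d z z3 < \<delta>/2" "d x x3 < \<delta>/2"
        using hausdorff_metric_max_dist_lessD[OF sN r c(3)] by blast
      have rM: "x1 \<in> M" "y1 \<in> M" "y2 \<in> M" "z2 \<in> M" "z3 \<in> M" "x3 \<in> M"
        using sq.nonempty_compactsD(3)[OF r(1)] 1(1) 2(1) 3(1) by auto
      have M: "x \<in> M" "y \<in> M" "z \<in> M" using sM c by blast+
      have "d x1 x3 < \<delta>" "d y1 y2 < \<delta>" "d z2 z3 < \<delta>"
        using triangle''[of x1 x x3] triangle''[of y1 y y2] triangle''[of z2 z z3] 1 2 3 rM M by linarith+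
      then have "d x1 y1 < inverse (real (Suc n))"
        using \<delta>(3) 1(1) 2(1) 3(1) unfolding cycle_modulus_def by blast
      moreover have "d x y \<le> d x x1 + (d x1 y1 + d y y1)"
        using triangle[of x x1 y] triangle'[of x1 y1 y] rM M by linarith
      ultimately show False using 1 n \<delta>(2) by linarith
    qed
    define K where "K = fst ` s"
    have K: "x \<in> K \<longleftrightarrow> (x, x) \<in> s" for x unfolding K_def using refl by force
    have "linear_order_on K s"
      unfolding order_on_defs
    proof (intro conjI)
      show "s \<subseteq> K \<times> K" using refl K by auto
      show "refl_on K s" using K by (auto simp: refl_on_def)
      show "trans s"
      proof (rule transI)
        fix x y z assume xyz: "(x, y) \<in> s" "(y, z) \<in> s"
        then have "(x, z) \<in> s \<or> (z, x) \<in> s" using refl total by blast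
        then show "(x, z) \<in> s" using cyc[OF xyz] xyz by blast
      qed
      show "antisym s"
        using cyc refl by (intro antisymI) blast
      show "total_on K s" using total K by (auto simp: total_on_def)
    qed
    then have "(K, s) \<in> Ktot mtopology"
      using sq.nonempty_compactsD(1,2)[OF sN] by (rule KtotI)
    then show "s \<in> snd ` Ktot mtopology" by force
  qed
  ultimately show ?thesis using gdelta_in_Int by metis
qed

text \<open>Taking a pair to its order is an isometry from \<^const>\<open>d_part\<close> onto a \<open>G\<^sub>\<delta>\<close> subset of the
  complete separable hyperspace of the square, and such subsets are Polish.\<close>

lemma Polish_space_Ktot:
  assumes mcomplete "separable_space mtopology"
  shows "Polish_space (Metric_space.mtopology (Ktot mtopology) (d_part mtopology d))"
proof -
  let ?S = "snd ` Ktot mtopology"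
  have S: "?S \<subseteq> sq.nonempty_compacts" using KtotD(8) by force
  interpret dp: Metric_space "Ktot mtopology" "d_part mtopology d" by (rule Metric_space_d_part)
  interpret sub: Submetric sq.nonempty_compacts sq.hausdorff_metric ?S by unfold_locales (rule S)
  interpret iso: Metric_space12 "Ktot mtopology" "d_part mtopology d" ?S sq.hausdorff_metric ..
  have "homeomorphic_map dp.mtopology sub.sub.mtopology snd"
    using d_part_eq_hausdorff_metric by (intro iso.isometry_imp_homeomorphic_map) auto
  then have hom: "dp.mtopology homeomorphic_space subtopology hyp.mtopology ?S"
    using homeomorphic_map_imp_homeomorphic_space by (auto simp: sub.mtopology_submetric)
  have "hyp.mcomplete"
    using sq.mcomplete_hausdorff_metric mcomplete_max_dist[OF assms(1)] by blast
  then have "completely_metrizable_space (subtopology hyp.mtopology ?S)"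
    using completely_metrizable_space_gdelta_in[OF _ gdelta_in_Ktot]
      hyp.completely_metrizable_space_mtopology by blast
  moreover have "separable_space (subtopology hyp.mtopology ?S)"
    using hyp.separable_space_subtopology_mtopology[OF sq.separable_space_hausdorff_metric S]
      separable_space_max_dist[OF assms(2)] mtopology_max_dist by simp
  ultimately show ?thesis
    using hom homeomorphic_completely_metrizable_space homeomorphic_separable_space
    unfolding Polish_space_def by blast
qed

end

section \<open>No Lipschitz bound between the two metrics\<close>

lemma linear_order_on_injective_key:
  fixes k :: "'b \<Rightarrow> 'c::linorder"
  assumes "inj_on g A" "inj_on k A"
  shows "linear_order_on (g ` A) {(g i, g j) | i j. i \<in> A \<and> j \<in> A \<and> k i \<le> k j}"
proof -
  define r where "r = {(g i, g j) | i j. i \<in> A \<and> j \<in> A \<and> k i \<le> k j}"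
  have mem: "(g i, g j) \<in> r \<longleftrightarrow> k i \<le> k j" if "i \<in> A" "j \<in> A" for i j
    using that inj_onD[OF assms(1)] unfolding r_def by blast
  have sub: "r \<subseteq> g ` A \<times> g ` A" unfolding r_def by blast
  have "trans r"
  proof (rule transI)
    fix x y z assume xyz: "(x, y) \<in> r" "(y, z) \<in> r"
    obtain i j where ij: "i \<in> A" "j \<in> A" "x = g i" "y = g j" using sub xyz(1) by blast
    obtain l where l: "l \<in> A" "z = g l" using sub xyz(2) by blast
    have "k i \<le> k j" "k j \<le> k l" using xyz mem ij l by auto
    then show "(x, z) \<in> r" using mem ij l by simp
  qed
  moreover have "antisym r"
  proof (rule antisymI)
    fix x y assume xy: "(x, y) \<in> r" "(y, x) \<in> r"
    obtain i j where ij: "i \<in> A" "j \<in> A" "x = g i" "y = g j" using sub xy(1) by blast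
    have "k i = k j" using xy mem ij by (simp add: order_antisym)
    then show "x = y" using ij inj_onD[OF assms(2)] by blast
  qed
  moreover have "refl_on (g ` A) r" "total_on (g ` A) r"
    using mem linear unfolding refl_on_def total_on_def by auto
  ultimately show ?thesis using sub unfolding order_on_defs r_def[symmetric] by blast
qed

text \<open>On the grid \<open>{0, 1/n, ..., 1}\<close> with \<open>n\<close> odd, the first order puts the even grid points before the odd
  ones and starts with \<open>0\<close>; the second puts the odd ones before the even ones and starts with
  \<open>1\<close>. Since each location is within \<open>1/n\<close> of an even and of an odd grid point, every pair of
  locations is approximated by a pair in either order, and \<^const>\<open>d_part\<close> is at most \<open>1/n\<close>. A monotone
  correspondence, however, relates the two least elements, which are at distance 1.\<close>

lemma d_part_d_tot_not_Lipschitz: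
  fixes e :: real assumes e: "e > 0"
  shows "\<exists>K1\<in>Ktot (top_of_set {0..1::real}). \<exists>K2\<in>Ktot (top_of_set {0..1::real}).
    K1 \<noteq> K2 \<and> d_part (top_of_set {0..1}) dist K1 K2 \<le> e * d_tot (top_of_set {0..1}) dist K1 K2"
proof -
  interpret sub: Submetric UNIV dist "{0..1::real}" by unfold_locales simp
  have top: "sub.sub.mtopology = top_of_set {0..1::real}" by (simp add: sub.mtopology_submetric)
  obtain m where m: "inverse (real (Suc m)) < e" using reals_Archimedean[OF e] by blast
  define n where "n = 2 * m + 1"
  have n: "odd n" "n > 0" unfolding n_def by auto
  have "1 / real n \<le> inverse (real (Suc m))" unfolding n_def by (simp add: field_simps)
  with m have ne: "1 / real n \<le> e" by linarith
  define g where "g i = real i / real n" for i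
  have inj: "inj_on g {..n}" unfolding g_def using n by (auto simp: inj_on_def)
  \<comment> \<open>Positions of the grid points in the two orders. In the second, the odd points descend, so
    that the odd number \<open>n\<close> comes first; the offset \<open>n + 1\<close> puts the other parity behind.\<close>
  define k1 where "k1 j = (if even j then j else n + 1 + j)" for j
  define k2 where "k2 j = (if odd j then n - j else n + 1 + j)" for j
  define r1 where "r1 = {(g i, g j) | i j. i \<in> {..n} \<and> j \<in> {..n} \<and> k1 i \<le> k1 j}"
  define r2 where "r2 = {(g i, g j) | i j. i \<in> {..n} \<and> j \<in> {..n} \<and> k2 i \<le> k2 j}"
  let ?K = "g ` {..n}"
  have lin1: "linear_order_on ?K r1" unfolding r1_def
    by (intro linear_order_on_injective_key inj) (auto simp: inj_on_def k1_def)
  have lin2: "linear_order_on ?K r2" unfolding r2_def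
    by (intro linear_order_on_injective_key inj) (auto simp: inj_on_def k2_def)
  have I: "(?K, r) \<in> Ktot (top_of_set {0..1})" if lin: "linear_order_on ?K r" for r
  proof -
    have KI: "?K \<subseteq> {0..1}" using n unfolding g_def by (auto simp: divide_le_eq)
    have r: "r \<subseteq> ?K \<times> ?K" using linear_order_onD(1)[OF lin] .
    then have "finite r" by (rule finite_subset) simp
    moreover have "r \<subseteq> topspace (prod_topology (top_of_set {0..1}) (top_of_set {0..1}))"
      using r KI by auto
    ultimately have "compactin (prod_topology (top_of_set {0..1}) (top_of_set {0..1})) r"
      by (intro finite_imp_compactin)
    moreover have "r \<noteq> {}" using linear_order_onD(2)[OF lin, of "g 0"] by auto
    ultimately show ?thesis using sub.sub.KtotI[OF lin, unfolded top] by blast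
  qed
  have step: "dist (g i) (g j) \<le> 1 / real n" if "i \<le> Suc j" "j \<le> Suc i" for i j
  proof -
    have "\<bar>real i - real j\<bar> \<le> 1" using that by auto
    then have "\<bar>real i - real j\<bar> / real n \<le> 1 / real n" by (rule divide_right_mono) simp
    moreover have "dist (g i) (g j) = \<bar>real i - real j\<bar> / real n"
      using n unfolding g_def dist_real_def by (simp add: diff_divide_distrib[symmetric])
    ultimately show ?thesis by simp
  qed
  \<comment> \<open>Neighbours of prescribed parity; rounding up to odd stays in the grid because \<open>n\<close> is odd.\<close>
  define ev where "ev i = (if even i then i else i - 1)" for i :: nat
  define od where "od i = (if odd i then i else i + 1)" for i :: nat
  have ev: "even (ev i)" "ev i \<le> i" "i \<le> Suc (ev i)" for i unfolding ev_def by auto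
  have od: "odd (od i)" "i \<le> od i" "od i \<le> Suc i" for i unfolding od_def by auto
  have odn: "od i \<le> n" if "i \<le> n" for i
    using that n(1) unfolding od_def by (cases "i = n") auto
  have mem1: "(g (ev i), g (od j)) \<in> r1" if "i \<le> n" "j \<le> n" for i j
  proof -
    have "k1 (ev i) \<le> k1 (od j)" using ev(1)[of i] ev(2)[of i] od(1)[of j] that unfolding k1_def by auto
    then show ?thesis unfolding r1_def using ev(2)[of i] odn that by fastforce
  qed
  have mem2: "(g (od i), g (ev j)) \<in> r2" if "i \<le> n" "j \<le> n" for i j
  proof -
    have "k2 (od i) \<le> k2 (ev j)" using ev(1)[of j] od(1)[of i] unfolding k2_def by auto
    then show ?thesis unfolding r2_def using ev(2)[of j] odn that by fastforce
  qed
  have ds: "dist (g i) (g (ev i)) \<le> 1 / real n" "dist (g i) (g (od i)) \<le> 1 / real n"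
    "dist (g (ev i)) (g i) \<le> 1 / real n" "dist (g (od i)) (g i) \<le> 1 / real n" for i
    using ev[of i] od[of i] by (auto intro!: step)
  have part: "d_part (top_of_set {0..1}) dist (?K, r1) (?K, r2) \<le> 1 / real n"
  proof (rule sub.sub.d_part_le[unfolded top, OF I[OF lin1] I[OF lin2]])
    show "\<exists>y y'. (y, y') \<in> r2 \<and> dist x y \<le> 1 / real n \<and> dist x' y' \<le> 1 / real n"
      if "(x, x') \<in> r1" for x x'
      using that mem2 ds unfolding r1_def by blast
    show "\<exists>x x'. (x, x') \<in> r1 \<and> dist x y \<le> 1 / real n \<and> dist x' y' \<le> 1 / real n"
      if "(y, y') \<in> r2" for y y'
      using that mem1 ds unfolding r2_def by blast
  qed
  have tot: "1 \<le> d_tot (top_of_set {0..1}) dist (?K, r1) (?K, r2)"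
  proof (rule ccontr)
    assume "\<not> ?thesis"
    then have "d_tot (top_of_set {0..1}) dist (?K, r1) (?K, r2) < 1" by simp
    then obtain R where R0: "R \<in> monotone_correspondences (?K, r1) (?K, r2)"
      and Rd: "\<And>x y. (x, y) \<in> R \<Longrightarrow> dist x y < 1"
      using sub.sub.d_tot_lessD[unfolded top, OF I[OF lin1] I[OF lin2], of 1] by blast
    note mc = iffD1[OF sub.sub.monotone_correspondences_iff[unfolded top, OF I[OF lin1] I[OF lin2]] R0]
    note R = mc[THEN conjunct1] mc[THEN conjunct2, THEN conjunct1]
      mc[THEN conjunct2, THEN conjunct2, THEN conjunct1]
      mc[THEN conjunct2, THEN conjunct2, THEN conjunct2]
    have g0: "g 0 \<in> ?K" and gn: "g n \<in> ?K" by auto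
    obtain y where y: "(g 0, y) \<in> R" using R(2) g0 by blast
    obtain x where x: "(x, g n) \<in> R" using R(3) gn by blast
    have min1: "(g 0, x) \<in> r1" if "x \<in> ?K" for x
      using that unfolding r1_def k1_def by (force simp del: of_nat_0)
    have min2: "(g n, y) \<in> r2" if "y \<in> ?K" for y
      using that n(1) unfolding r2_def k2_def by force
    \<comment> \<open>If neither partner of a least element were least, the two pairs would cross.\<close>
    have "(x, g 0) \<in> r1 \<or> (y, g n) \<in> r2" using R(4) x y by blast
    then have "x = g 0 \<or> y = g n"
      using min1[of x] min2[of y] x y R(1) linear_order_onD(4)[OF lin1] linear_order_onD(4)[OF lin2]
      by blast
    then have "(g 0, g n) \<in> R" using x y by blast
    then have "dist (g 0) (g n) < 1" by (rule Rd)
    then show False using n by (simp add: g_def)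
  qed
  have "(?K, r1) \<noteq> (?K, r2)"
    using sub.sub.d_tot_refl[unfolded top, OF I[OF lin1]] tot by auto
  moreover have "d_part (top_of_set {0..1}) dist (?K, r1) (?K, r2) \<le>
      e * d_tot (top_of_set {0..1}) dist (?K, r1) (?K, r2)"
    using part ne tot mult_left_mono[OF tot, of e] e by linarith
  ultimately show ?thesis using I[OF lin1] I[OF lin2] by blast
qed

section \<open>The ordered Hausdorff topology\<close>

theorem theorem1p14:
  fixes X :: "'a topology" and d :: "'a \<Rightarrow> 'a \<Rightarrow> real"
  assumes "Metric_space (topspace X) d"
    and "Metric_space.mtopology (topspace X) d = X"
  shows "(Metric_space (Ktot X) (d_part X d) \<and>
          Metric_space (Ktot X) (d_tot X d) \<and>
          Metric_space.mtopology (Ktot X) (d_part X d) =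
            Metric_space.mtopology (Ktot X) (d_tot X d) \<and>
          (\<forall>d'. Metric_space (topspace X) d' \<and>
                Metric_space.mtopology (topspace X) d' = X \<longrightarrow>
             Metric_space.mtopology (Ktot X) (d_part X d') =
               Metric_space.mtopology (Ktot X) (d_part X d) \<and>
             Metric_space.mtopology (Ktot X) (d_tot X d') =
               Metric_space.mtopology (Ktot X) (d_tot X d))) \<and>
         (Polish_space X \<longrightarrow>
            Polish_space (Metric_space.mtopology (Ktot X) (d_part X d))) \<and>
         (\<forall>K1\<in>Ktot X. \<forall>K2\<in>Ktot X.
            Hausdorff_dist d (fst K1) (fst K2) \<le> d_part X d K1 K2 \<and>
            d_part X d K1 K2 \<le> d_tot X d K1 K2) \<and>
         (\<forall>\<epsilon>>0. \<exists>K1\<in>Ktot (top_of_set {0..1::real}). \<exists>K2\<in>Ktot (top_of_set {0..1::real}).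
            K1 \<noteq> K2 \<and>
            d_part (top_of_set {0..1}) dist K1 K2 \<le> \<epsilon> * d_tot (top_of_set {0..1}) dist K1 K2)"
proof -
  interpret m: Metric_space "topspace X" d by fact
  note top = assms(2)
  have indep: "Metric_space.mtopology (Ktot X) (d_part X d') = Metric_space.mtopology (Ktot X) (d_part X d)"
    "Metric_space.mtopology (Ktot X) (d_tot X d') = Metric_space.mtopology (Ktot X) (d_tot X d)"
    if d': "Metric_space (topspace X) d'" "Metric_space.mtopology (topspace X) d' = X" for d'
  proof -
    show tot: "Metric_space.mtopology (Ktot X) (d_tot X d') = Metric_space.mtopology (Ktot X) (d_tot X d)"
      by (rule mtopology_d_tot_equivalent[OF d' assms])
    then show "Metric_space.mtopology (Ktot X) (d_part X d') = Metric_space.mtopology (Ktot X) (d_part X d)"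
      using Metric_space.mtopology_d_part_eq_d_tot[OF d'(1), unfolded d'(2)]
        m.mtopology_d_part_eq_d_tot[unfolded top] by simp
  qed
  have "Polish_space (Metric_space.mtopology (Ktot X) (d_part X d))" if X: "Polish_space X"
  proof -
    obtain M d' where d': "Metric_space M d'" "Metric_space.mcomplete M d'" "X = Metric_space.mtopology M d'"
      using X unfolding Polish_space_def completely_metrizable_space_def by blast
    have M: "topspace X = M" using Metric_space.topspace_mtopology[OF d'(1)] d'(3) by simp
    have "Polish_space (Metric_space.mtopology (Ktot X) (d_part X d'))"
      using Metric_space.Polish_space_Ktot[OF d'(1,2)] X d'(3) unfolding Polish_space_def by simp
    then show ?thesis using indep(1)[of d'] d' M by simp
  qed
  moreover have "Hausdorff_dist d (fst K1) (fst K2) \<le> d_part X d K1 K2"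
    "d_part X d K1 K2 \<le> d_tot X d K1 K2" if "K1 \<in> Ktot X" "K2 \<in> Ktot X" for K1 K2
    using m.Hausdorff_dist_le_d_part[unfolded top, of "fst K1" "snd K1" "fst K2" "snd K2"]
      m.d_part_le_d_tot[unfolded top, of "fst K1" "snd K1" "fst K2" "snd K2"] that by auto
  ultimately show ?thesis
    using m.Metric_space_d_part[unfolded top] m.Metric_space_d_tot[unfolded top]
      m.mtopology_d_part_eq_d_tot[unfolded top] indep d_part_d_tot_not_Lipschitz by blast
qed

end
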